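(* There is an infinite set $\mathcal{G}$ of cubic bridgeless graphs such that any two distinct members $G, G' \in \mathcal{G}$ are $cc$-incomparable, that is, there is no cycle-continuous mapping $E(G)\to E(G')$ and no cycle-continuous mapping $E(G')\to E(G)$.
   Context: Graphs are finite and may have parallel edges and loops. A \emph{cycle} in a graph is a set of edges such that every vertex is incident with an even number of them (a loop counting twice); so a cycle is an element of the $\mathbb{Z}_2$-cycle space, and the empty set is a cycle. A mapping $f:E(G)\to E(H)$ is \emph{cycle-continuous} ($cc$) if for every cycle $C\subseteq E(H)$ the preimage $f^{-1}(C)$ is a cycle in $G$. *)

theory Defs
  imports "HOL-Library.Multiset" "HOL-Library.FuncSet"
begin

text \<open>Undirected multigraphs. The ends of an edge form a multiset of size two, so an edge
  \<open>e\<close> with \<open>ends G e = {#v, v#}\<close> is a loop at \<open>v\<close>.\<close>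

record ('v, 'e) multigraph =
  verts :: "'v set"
  edges :: "'e set"
  ends :: "'e \<Rightarrow> 'v multiset"

locale fin_multigraph =
  fixes G :: "('v, 'e) multigraph" (structure)
  assumes finite_verts: "finite (verts G)"
    and finite_edges: "finite (edges G)"
    and size_ends: "e \<in> edges G \<Longrightarrow> size (ends G e) = 2"
    and ends_in_verts: "e \<in> edges G \<Longrightarrow> set_mset (ends G e) \<subseteq> verts G"

text \<open>The number of incidences of \<open>v\<close> with edges of \<open>F\<close>; a loop at \<open>v\<close> contributes two,
  its multiplicity in \<open>ends\<close>.\<close>

definition degree_in :: "('v, 'e) multigraph \<Rightarrow> 'e set \<Rightarrow> 'v \<Rightarrow> nat" where
  "degree_in G F v = (\<Sum>e\<in>F. count (ends G e) v)"

definition cubic :: "('v, 'e) multigraph \<Rightarrow> bool" where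
  "cubic G \<longleftrightarrow> (\<forall>v\<in>verts G. degree_in G (edges G) v = 3)"

definition adjacency :: "('v, 'e) multigraph \<Rightarrow> 'v rel" where
  "adjacency G = {(u, v). \<exists>e\<in>edges G. ends G e = {#u, v#}}"

definition connected_in :: "('v, 'e) multigraph \<Rightarrow> 'v \<Rightarrow> 'v \<Rightarrow> bool" where
  "connected_in G u v \<longleftrightarrow> (u, v) \<in> (adjacency G)\<^sup>*"

definition delete_edge :: "('v, 'e) multigraph \<Rightarrow> 'e \<Rightarrow> ('v, 'e) multigraph" where
  "delete_edge G e = G\<lparr>edges := edges G - {e}\<rparr>"

text \<open>A bridge is an edge whose ends lie in different components once it is deleted; in
  particular, a loop is never a bridge.\<close>

definition bridge :: "('v, 'e) multigraph \<Rightarrow> 'e \<Rightarrow> bool" where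
  "bridge G e \<longleftrightarrow> e \<in> edges G \<and>
     (\<exists>u v. ends G e = {#u, v#} \<and> \<not> connected_in (delete_edge G e) u v)"

definition bridgeless :: "('v, 'e) multigraph \<Rightarrow> bool" where
  "bridgeless G \<longleftrightarrow> (\<forall>e\<in>edges G. \<not> bridge G e)"

text \<open>Cycles are the elements of the binary cycle space, not only simple circuits.\<close>

definition is_cycle :: "('v, 'e) multigraph \<Rightarrow> 'e set \<Rightarrow> bool" where
  "is_cycle G C \<longleftrightarrow> C \<subseteq> edges G \<and> (\<forall>v\<in>verts G. even (degree_in G C v))"

definition cycle_continuous ::
    "('v, 'e) multigraph \<Rightarrow> ('w, 'f) multigraph \<Rightarrow> ('e \<Rightarrow> 'f) \<Rightarrow> bool" where
  "cycle_continuous G H f \<longleftrightarrow> f \<in> edges G \<rightarrow> edges H \<and>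
     (\<forall>C. is_cycle H C \<longrightarrow> is_cycle G (f -` C \<inter> edges G))"

definition cc_incomparable :: "('v, 'e) multigraph \<Rightarrow> ('w, 'f) multigraph \<Rightarrow> bool" where
  "cc_incomparable G H \<longleftrightarrow>
     \<not> (\<exists>f. cycle_continuous G H f) \<and> \<not> (\<exists>f. cycle_continuous H G f)"

end

theory Submission
  imports Defs
begin

text \<open>A cycle-continuous map sends the star of every vertex of a cubic graph to an edge cut, which
  in a bridgeless target has exactly three edges. The graphs are chains of copies of one Blanusa
  snark \<open>B\<close>, obtained by repeatedly deleting a vertex \<open>y\<close> of one copy and a vertex \<open>x\<close> of the next
  and joining the dangling edges. Since \<open>B\<close> is cyclically 4-edge-connected, the only 3-edge cuts
  of a chain are the stars of the copies, so a cycle-continuous map between chains yields for every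
  copy a map from its stars to the stars of the target. The parity of the number of
  preimages of a star is constant on the interior of a target copy. If it is odd somewhere, the
  map is an isomorphism onto that copy. Otherwise at most nine stars are hit, and since \<open>B\<close>
  becomes 3-edge-colourable after removal of two suitable vertices, the target can be coloured
  properly at the stars that are hit; this would pull back to a 3-edge-colouring of \<open>B\<close>. As \<open>x\<close> and
  \<open>y\<close> lie in different orbits of the automorphism group, the copies are mapped to consecutive
  copies in order, preserving the twists of the gluings, and two marked gluings at the ends of
  each chain force equal lengths.\<close>

subsection \<open>The snark\<close>

text \<open>Vertices 0 and 17 are the ends at which copies are glued. The order puts the star of 0
  first (edges 0, 1, 2) and that of 17 last (24, 25, 26), so that gluing becomes a shift of edge
  numbers by 24.\<close>

definition snark_edges :: "(nat \<times> nat) list" where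
  "snark_edges =
    [(0, 1), (0, 12), (0, 16), (1, 2), (1, 3), (2, 4), (2, 5), (3, 6), (4, 7),
     (5, 6), (5, 8), (6, 9), (7, 10), (7, 11), (8, 10), (9, 12), (9, 13), (10, 14),
     (11, 15), (11, 16), (12, 15), (13, 14), (13, 16), (14, 15), (3, 17), (4, 17), (8, 17)]"

definition lo :: "nat \<Rightarrow> nat" where "lo e = fst (snark_edges ! e)"
definition hi :: "nat \<Rightarrow> nat" where "hi e = snd (snark_edges ! e)"

definition star_list :: "nat \<Rightarrow> nat list" where
  "star_list a = filter (\<lambda>e. lo e = a \<or> hi e = a) [0..<27]"

definition star :: "nat \<Rightarrow> nat set" where "star a = set (star_list a)"

lemma in_star_iff: "e \<in> star a \<longleftrightarrow> e < 27 \<and> (lo e = a \<or> hi e = a)"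
  by (auto simp: star_def star_list_def)

lemma finite_star [simp]: "finite (star a)"
  by (simp add: star_def)

lemma star_list_simps [simp]:
    "star_list 0 = [0, 1, 2]"
    "star_list (Suc 0) = [0, 3, 4]"
    "star_list 2 = [3, 5, 6]"
    "star_list 3 = [4, 7, 24]"
    "star_list 4 = [5, 8, 25]"
    "star_list 5 = [6, 9, 10]"
    "star_list 6 = [7, 9, 11]"
    "star_list 7 = [8, 12, 13]"
    "star_list 8 = [10, 14, 26]"
    "star_list 9 = [11, 15, 16]"
    "star_list 10 = [12, 14, 17]"
    "star_list 11 = [13, 18, 19]"
    "star_list 12 = [1, 15, 20]"
    "star_list 13 = [16, 21, 22]"
    "star_list 14 = [17, 21, 23]"
    "star_list 15 = [18, 20, 23]"
    "star_list 16 = [2, 19, 22]"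
    "star_list 17 = [24, 25, 26]"
  by code_simp+

lemma distinct_star_list [simp]: "distinct (star_list a)"
  by (simp add: star_list_def)

lemma all_less_18:
  "(\<forall>a<(18::nat). P a) \<longleftrightarrow> P 0 \<and> P 1 \<and> P 2 \<and> P 3 \<and> P 4 \<and> P 5 \<and> P 6 \<and> P 7 \<and> P 8 \<and> P 9 \<and>
     P 10 \<and> P 11 \<and> P 12 \<and> P 13 \<and> P 14 \<and> P 15 \<and> P 16 \<and> P 17"
  by (simp add: numeral_eq_Suc All_less_Suc conj_ac)

lemma all_less_27:
  "(\<forall>a<(27::nat). P a) \<longleftrightarrow> (\<forall>a<18. P a) \<and>
     P 18 \<and> P 19 \<and> P 20 \<and> P 21 \<and> P 22 \<and> P 23 \<and> P 24 \<and> P 25 \<and> P 26"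
  by (simp add: numeral_eq_Suc All_less_Suc conj_ac)

lemma lo_simps [simp]:
  "lo 0 = 0"
  "lo (Suc 0) = 0"
  "lo 2 = 0"
  "lo 3 = 1"
  "lo 4 = 1"
  "lo 5 = 2"
  "lo 6 = 2"
  "lo 7 = 3"
  "lo 8 = 4"
  "lo 9 = 5"
  "lo 10 = 5"
  "lo 11 = 6"
  "lo 12 = 7"
  "lo 13 = 7"
  "lo 14 = 8"
  "lo 15 = 9"
  "lo 16 = 9"
  "lo 17 = 10"
  "lo 18 = 11"
  "lo 19 = 11"
  "lo 20 = 12"
  "lo 21 = 13"
  "lo 22 = 13"
  "lo 23 = 14"
  "lo 24 = 3"
  "lo 25 = 4"
  "lo 26 = 8"
  by code_simp+

lemma hi_simps [simp]:
  "hi 0 = 1"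
  "hi (Suc 0) = 12"
  "hi 2 = 16"
  "hi 3 = 2"
  "hi 4 = 3"
  "hi 5 = 4"
  "hi 6 = 5"
  "hi 7 = 6"
  "hi 8 = 7"
  "hi 9 = 6"
  "hi 10 = 8"
  "hi 11 = 9"
  "hi 12 = 10"
  "hi 13 = 11"
  "hi 14 = 10"
  "hi 15 = 12"
  "hi 16 = 13"
  "hi 17 = 14"
  "hi 18 = 15"
  "hi 19 = 16"
  "hi 20 = 15"
  "hi 21 = 14"
  "hi 22 = 16"
  "hi 23 = 15"
  "hi 24 = 17"
  "hi 25 = 17"
  "hi 26 = 17"
  by code_simp+

lemma card_star: assumes "a < 18" shows "card (star a) = 3"
proof -
  have "\<forall>a<18. length (star_list a) = 3"
    by (simp add: all_less_18)
  then show ?thesis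
    using assms by (simp add: star_def distinct_card)
qed

lemma snark_ends:
  assumes "e < 27"
  shows "lo e < hi e" "hi e < 18" "e < 3 \<Longrightarrow> lo e = 0" "3 \<le> e \<Longrightarrow> 1 \<le> lo e"
    "e < 24 \<Longrightarrow> hi e \<le> 16" "24 \<le> e \<Longrightarrow> hi e = 17"
proof -
  have "\<forall>e<27. lo e < hi e \<and> hi e < 18 \<and> (if e < 3 then lo e = 0 else 1 \<le> lo e) \<and>
     (if e < 24 then hi e \<le> 16 else hi e = 17)"
    by (simp add: all_less_27 all_less_18)
  from this[rule_format, OF assms]
  show "lo e < hi e" "hi e < 18" "e < 3 \<Longrightarrow> lo e = 0" "3 \<le> e \<Longrightarrow> 1 \<le> lo e"
    "e < 24 \<Longrightarrow> hi e \<le> 16" "24 \<le> e \<Longrightarrow> hi e = 17"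
    by simp_all
qed

lemma star_0: "star 0 = {..<3}"
  by (auto simp: star_def)

lemma star_17: "star 17 = {24..<27}"
  by (auto simp: star_def)

text \<open>Every edge lies in exactly two stars, those of its distinct ends. The resulting parity
  passes evenness on to virtual stars and controls the fibres of maps on stars.\<close>

lemma handshake:
  assumes "D \<subseteq> {..<27}"
  shows "(\<Sum>a<18. card (D \<inter> star a)) = 2 * card D"
proof -
  have fin: "finite D"
    using assms finite_subset by blast
  have "(\<Sum>a<18. card (D \<inter> star a)) = (\<Sum>a<(18::nat). \<Sum>e\<in>D. of_bool (e \<in> star a))"
    using fin by (intro sum.cong refl) (simp add: Int_def flip: Collect_conj_eq)
  also have "\<dots> = (\<Sum>e\<in>D. \<Sum>a<18. of_bool (e \<in> star a))"
    by (rule sum.swap)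
  also have "\<dots> = (\<Sum>e\<in>D. 2)"
  proof (rule sum.cong[OF refl])
    fix e assume "e \<in> D"
    then have e: "e < 27" using assms by auto
    then have "{a. a < 18 \<and> e \<in> star a} = {lo e, hi e}"
      using snark_ends[OF e] by (auto simp: in_star_iff)
    then have "card {a. a < 18 \<and> e \<in> star a} = 2"
      using snark_ends(1)[OF e] by simp
    then show "(\<Sum>a<18. of_bool (e \<in> star a)) = (2::nat)"
      by (simp add: lessThan_def flip: Collect_conj_eq)
  qed
  finally show ?thesis by simp
qed

text \<open>An edge numbered at least 3 has its lower end at least 1, so these edges join each
  interior vertex other than 1 to a smaller interior one: a spanning tree rooted at 1, along which
  parities propagate.\<close>

lemma inner_tree:
  assumes "2 \<le> b" "b \<le> 16"
  obtains e where "3 \<le> e" "e < 24" "hi e = b"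
proof -
  have "\<forall>b<18. 2 \<le> b \<and> b \<le> 16 \<longrightarrow> list_ex (\<lambda>e. 3 \<le> e \<and> e < 24 \<and> hi e = b) (star_list b)"
    by (simp add: all_less_18)
  then have "list_ex (\<lambda>e. 3 \<le> e \<and> e < 24 \<and> hi e = b) (star_list b)"
    using assms by simp
  then show thesis
    using that by (auto simp: list_ex_iff)
qed

section \<open>Edge colourings of the snark\<close>

lemma not_colourable:
  assumes "\<forall>e<27. c e < (3::nat)" "\<forall>a<18. inj_on c (star a)"
  shows False
proof -
  \<comment> \<open>Colours 0 and 1 become propositional variables and colour 2 is the absence of
    both. Each variable must then hold on exactly one edge of every star, which leaves a
    propositional problem for \<open>sat\<close>.\<close>
  define p q where "p e = (c e = 0)" and "q e = (c e = 1)" for e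
  have pq: "\<not> (p e \<and> q e)" for e
    by (auto simp: p_def q_def)
  have "(p x \<or> p y \<or> p z) \<and> (q x \<or> q y \<or> q z) \<and>
      \<not> (p x \<and> p y) \<and> \<not> (p x \<and> p z) \<and> \<not> (p y \<and> p z) \<and>
      \<not> (q x \<and> q y) \<and> \<not> (q x \<and> q z) \<and> \<not> (q y \<and> q z)"
    if "star_list a = [x, y, z]" "a < 18" for a x y z
  proof -
    have "x < 27" "y < 27" "z < 27" "distinct [x, y, z]" 
      using that(1) in_star_iff[of _ a] distinct_star_list[of a] unfolding star_def by auto
    moreover have "distinct (map c [x, y, z])"
      using assms(2) that distinct_star_list[of a] unfolding distinct_map star_def by metis
    moreover have "c x < 3" "c y < 3" "c z < 3"
      using assms(1) calculation by auto
    ultimately show ?thesis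
      unfolding p_def q_def by (simp; linarith)
  qed
  note * = this
  note stars = *[OF star_list_simps(1)]
    *[OF star_list_simps(2)]
    *[OF star_list_simps(3)]
    *[OF star_list_simps(4)]
    *[OF star_list_simps(5)]
    *[OF star_list_simps(6)]
    *[OF star_list_simps(7)]
    *[OF star_list_simps(8)]
    *[OF star_list_simps(9)]
    *[OF star_list_simps(10)]
    *[OF star_list_simps(11)]
    *[OF star_list_simps(12)]
    *[OF star_list_simps(13)]
    *[OF star_list_simps(14)]
    *[OF star_list_simps(15)]
    *[OF star_list_simps(16)]
    *[OF star_list_simps(17)]
    *[OF star_list_simps(18)]
  note edges = pq[of 0] pq[of "Suc 0"] pq[of 2] pq[of 3] pq[of 4] pq[of 5] pq[of 6] pq[of 7]
    pq[of 8] pq[of 9] pq[of 10] pq[of 11] pq[of 12] pq[of 13] pq[of 14] pq[of 15] pq[of 16]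
    pq[of 17] pq[of 18] pq[of 19] pq[of 20] pq[of 21] pq[of 22] pq[of 23] pq[of 24] pq[of 25]
    pq[of 26]
  show False
    using stars[simplified] edges by sat
qed

text \<open>Each entry \<open>(u, v, cs)\<close> is a colouring proper except at \<open>u\<close> and \<open>v\<close>. The listed pairs are
  those in a common residue class modulo 6, so that any seven interior vertices contain one.\<close>

definition near_colourings :: "(nat \<times> nat \<times> nat list) list" where
  "near_colourings =
    [(1, 7, [0, 1, 2, 0, 0, 2, 1, 1, 0, 0, 2, 2, 2, 2, 1, 0, 1, 0, 0, 1, 2, 2, 0, 1, 2, 1, 0]),
     (1, 13, [0, 1, 2, 0, 0, 1, 2, 2, 0, 0, 1, 1, 1, 2, 2, 0, 2, 0, 0, 1, 2, 2, 0, 1, 1, 2, 0]),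
     (2, 8, [0, 1, 2, 1, 2, 1, 0, 0, 0, 1, 2, 2, 1, 2, 2, 0, 1, 0, 0, 1, 2, 2, 0, 1, 1, 2, 0]),
     (2, 14, [0, 1, 2, 1, 2, 0, 0, 0, 1, 2, 1, 1, 0, 2, 2, 0, 2, 1, 1, 0, 2, 0, 1, 0, 1, 2, 0]),
     (3, 9, [0, 1, 2, 1, 2, 0, 2, 0, 1, 1, 0, 2, 0, 2, 2, 0, 0, 1, 1, 0, 2, 2, 1, 0, 0, 2, 1]),
     (3, 15, [0, 1, 2, 1, 2, 0, 2, 2, 1, 0, 1, 1, 0, 2, 2, 0, 2, 1, 1, 0, 2, 0, 1, 2, 1, 2, 0]),
     (4, 10, [0, 1, 2, 1, 2, 0, 2, 0, 0, 1, 0, 2, 1, 2, 1, 0, 1, 0, 0, 1, 2, 2, 0, 1, 1, 0, 2]),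
     (4, 16, [0, 1, 2, 1, 2, 2, 0, 0, 0, 2, 1, 1, 1, 2, 0, 0, 2, 2, 1, 0, 2, 1, 0, 0, 1, 0, 2]),
     (5, 11, [0, 1, 2, 1, 2, 0, 2, 0, 1, 2, 2, 1, 0, 2, 1, 0, 2, 2, 0, 0, 2, 0, 1, 1, 1, 2, 0]),
     (6, 12, [0, 1, 2, 1, 2, 0, 2, 0, 1, 0, 1, 1, 0, 2, 2, 0, 2, 1, 1, 0, 0, 0, 1, 2, 1, 2, 0]),
     (7, 13, [0, 1, 2, 1, 2, 0, 2, 1, 2, 0, 1, 2, 1, 2, 0, 0, 1, 2, 1, 0, 2, 1, 1, 0, 0, 1, 2]),
     (8, 14, [0, 1, 2, 1, 2, 2, 0, 0, 1, 2, 1, 1, 0, 2, 2, 0, 2, 1, 1, 0, 2, 0, 1, 0, 1, 0, 2]),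
     (9, 15, [0, 1, 2, 1, 2, 2, 0, 1, 0, 2, 1, 0, 2, 1, 0, 0, 0, 1, 2, 0, 2, 2, 1, 0, 0, 1, 2]),
     (10, 16, [0, 1, 2, 1, 2, 2, 0, 0, 1, 2, 1, 1, 0, 2, 0, 0, 2, 2, 1, 0, 2, 1, 0, 0, 1, 0, 2])]"

lemma near_colourings:
  assumes "(u, v, cs) \<in> set near_colourings"
  shows "\<forall>e<27. cs ! e < 3" "\<forall>a<18. a \<noteq> u \<longrightarrow> a \<noteq> v \<longrightarrow> distinct (map ((!) cs) (star_list a))"
proof -
  have stars: "map (\<lambda>a. (a, star_list a)) [0..<18] =
    [(0, [0, 1, 2]),
     (1, [0, 3, 4]),
     (2, [3, 5, 6]),
     (3, [4, 7, 24]),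
     (4, [5, 8, 25]),
     (5, [6, 9, 10]),
     (6, [7, 9, 11]),
     (7, [8, 12, 13]),
     (8, [10, 14, 26]),
     (9, [11, 15, 16]),
     (10, [12, 14, 17]),
     (11, [13, 18, 19]),
     (12, [1, 15, 20]),
     (13, [16, 21, 22]),
     (14, [17, 21, 23]),
     (15, [18, 20, 23]),
     (16, [2, 19, 22]),
     (17, [24, 25, 26])]"
    by code_simp
  have "list_all (\<lambda>(u, v, cs). length cs = 27 \<and> list_all (\<lambda>c. c < 3) cs) near_colourings"
    by code_simp
  then show "\<forall>e<27. cs ! e < 3"
    using assms by (fastforce simp: list_all_iff)
  have "list_all (\<lambda>(u, v, cs). list_all (\<lambda>(a, es). a = u \<or> a = v \<or> distinct (map ((!) cs) es))
      (map (\<lambda>a. (a, star_list a)) [0..<18])) near_colourings"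
    unfolding stars by code_simp
  then show "\<forall>a<18. a \<noteq> u \<longrightarrow> a \<noteq> v \<longrightarrow> distinct (map ((!) cs) (star_list a))"
    using assms by (fastforce simp: list_all_iff)
qed

lemma near_colourings_mod_6:
  "\<forall>u<18. \<forall>v<18. 1 \<le> u \<and> u < v \<and> v \<le> 16 \<and> u mod 6 = v mod 6 \<longrightarrow>
     (u, v) \<in> set (map (\<lambda>(u, v, cs). (u, v)) near_colourings)"
proof -
  have "map (\<lambda>(u, v, cs). (u, v)) near_colourings = [(1, 7), (1, 13), (2, 8), (2, 14), (3, 9), (3, 15), (4, 10), (4, 16), (5, 11), (6, 12), (7, 13), (8, 14), (9, 15), (10, 16)]"
    by (simp add: near_colourings_def)
  then show ?thesis
    by (simp only:) (simp add: all_less_18)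
qed

text \<open>At least seven of the 16 interior vertices lie outside \<open>W\<close>, so two of them
  agree modulo 6. The listed colouring that may fail only at these two is proper on \<open>W\<close>
  and at both ends.\<close>

lemma near_colouring:
  assumes "W \<subseteq> {1..16}" "card W \<le> 9"
  obtains c :: "nat \<Rightarrow> nat" where "\<forall>e<27. c e < 3" "\<forall>a\<in>W \<union> {0, 17}. inj_on c (star a)"
proof -
  let ?M = "{1..16} - W"
  have "card ?M \<ge> 7"
    using assms by (simp add: card_Diff_subset finite_subset[OF assms(1)])
  moreover have "card ((\<lambda>a. a mod 6) ` ?M) \<le> card {..<6::nat}"
    by (intro card_mono) auto
  ultimately have "\<not> inj_on (\<lambda>a. a mod 6) ?M"
    using card_image[of "\<lambda>a. a mod 6" ?M] by auto
  then obtain u v where "u \<in> ?M" "v \<in> ?M" "u mod 6 = v mod 6" "u < v"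
    unfolding inj_on_def by (metis linorder_neqE_nat)
  moreover obtain cs where "(u, v, cs) \<in> set near_colourings"
    using near_colourings_mod_6[rule_format, of u v] calculation by auto
  then have "\<forall>e<27. cs ! e < 3"
    "\<forall>a<18. a \<noteq> u \<longrightarrow> a \<noteq> v \<longrightarrow> distinct (map ((!) cs) (star_list a))"
    using near_colourings by blast+
  moreover have "inj_on ((!) cs) (star a)" if "a \<in> W \<union> {0, 17}" for a
  proof -
    have "a < 18" "a \<noteq> u" "a \<noteq> v"
      using that assms(1) calculation(1,2) by auto
    then have "distinct (map ((!) cs) (star_list a))"
      using calculation by blast
    then show ?thesis
      unfolding distinct_map star_def by blast
  qed
  ultimately show thesis
    by (intro that) auto
qed

section \<open>The cycle space and the three-edge cuts of the snark\<close>

text \<open>A generating set of the cycle space adapted to the gluing: cycles avoiding the ends 0 and 17,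
  and cycles through only one end, where \<open>p\<close> is the edge at that end that is not used.\<close>

definition inner_cycles :: "nat list list" where
  "inner_cycles = [[3, 4, 6, 7, 9], [12, 13, 17, 18, 23], [15, 16, 20, 21, 23], [18, 19, 21, 22, 23],
     [5, 6, 8, 10, 12, 14], [9, 10, 11, 14, 16, 17, 21]]"

definition right_cycle :: "nat \<Rightarrow> nat list" where
  "right_cycle p = [[5, 6, 10, 25, 26], [7, 9, 10, 24, 26], [3, 4, 5, 24, 25]] ! p"

definition left_cycle :: "nat \<Rightarrow> nat list" where
  "left_cycle p = [[1, 2, 15, 16, 22], [0, 2, 3, 5, 8, 13, 19], [0, 1, 4, 7, 11, 15]] ! p"

text \<open>Three edges form a cut iff their incidence vectors sum to zero over the two-element field.\<close>

definition inc :: "nat \<Rightarrow> bool list" where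
  "inc e = map (\<lambda>C. e \<in> set C)
     (inner_cycles @ [right_cycle 0, right_cycle 1, left_cycle 0, left_cycle 1])"

lemma even_star_list:
  assumes "list_all (\<lambda>C. distinct C \<and>
      (\<forall>a<18. even (length (filter (\<lambda>e. e \<in> set (star_list a)) C)))) Cs"
    "C \<in> set Cs" "a < 18"
  shows "even (card (set C \<inter> star a))"
proof -
  have "set C \<inter> star a = set (filter (\<lambda>e. e \<in> set (star_list a)) C)"
    by (auto simp: star_def)
  moreover have "distinct C" "even (length (filter (\<lambda>e. e \<in> set (star_list a)) C))"
    using assms by (auto simp: list_all_iff)
  ultimately show ?thesis
    by (metis distinct_card distinct_filter)
qed

lemma inner_cycles_even:
  assumes "C \<in> set inner_cycles" "a < 18"
  shows "even (card (set C \<inter> star a))"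
  by (rule even_star_list[OF _ assms]) (simp add: inner_cycles_def all_less_18)

lemma side_cycles_even:
  assumes "p < 3" "a < 18"
  shows "even (card (set (right_cycle p) \<inter> star a))" "even (card (set (left_cycle p) \<inter> star a))"
proof -
  have p: "p = 0 \<or> p = 1 \<or> p = 2" using assms by auto
  show "even (card (set (right_cycle p) \<inter> star a))"
    by (rule even_star_list[of "map right_cycle [0, 1, 2]"])
      (use p assms in \<open>auto simp: right_cycle_def all_less_18\<close>)
  show "even (card (set (left_cycle p) \<inter> star a))"
    by (rule even_star_list[of "map left_cycle [0, 1, 2]"])
      (use p assms in \<open>auto simp: left_cycle_def all_less_18\<close>)
qed

lemma inner_cycles_subset: "C \<in> set inner_cycles \<Longrightarrow> set C \<subseteq> {3..<24}"
  by (auto simp: inner_cycles_def)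

lemma inner_cycles_cover:
  assumes "3 \<le> e" "e < 24"
  obtains C where "C \<in> set inner_cycles" "e \<in> set C"
proof -
  have "\<forall>e<27. 3 \<le> e \<and> e < 24 \<longrightarrow> list_ex (\<lambda>C. e \<in> set C) inner_cycles"
    by (simp add: all_less_27 all_less_18 inner_cycles_def)
  then have "list_ex (\<lambda>C. e \<in> set C) inner_cycles"
    using assms by simp
  then show thesis
    using that by (auto simp: list_ex_iff)
qed

lemma right_cycle_subset: "p < 3 \<Longrightarrow> set (right_cycle p) \<subseteq> {3..<27}"
  and right_cycle_end: "p < 3 \<Longrightarrow> q < 3 \<Longrightarrow> 24 + q \<in> set (right_cycle p) \<longleftrightarrow> q \<noteq> p"
  and left_cycle_subset: "p < 3 \<Longrightarrow> set (left_cycle p) \<subseteq> {..<24}"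
  and left_cycle_end: "p < 3 \<Longrightarrow> q < 3 \<Longrightarrow> q \<in> set (left_cycle p) \<longleftrightarrow> q \<noteq> p"
  by (auto simp: right_cycle_def left_cycle_def less_Suc_eq numeral_3_eq_3)

definition inc_table :: "(bool list \<times> nat \<times> nat \<times> nat) list" where
  "inc_table = map (\<lambda>e. (inc e, e, lo e, hi e)) [0..<27]"

text \<open>Here \<open>z\<close> is the outcome of looking up the sum of two incidence vectors.
  \<open>None\<close> means that no edge completes the pair to a cut; otherwise the three edges must
  be distinct and share an end of the first.\<close>

definition closes :: "nat \<times> nat \<times> nat \<Rightarrow> nat \<times> nat \<times> nat \<Rightarrow> (nat \<times> nat \<times> nat) option \<Rightarrow> bool" where
  "closes x y z = (case x of (e, a, b) \<Rightarrow> case y of (e', a', b') \<Rightarrow> (case z of None \<Rightarrow> True | Some (e'', a'', b'') \<Rightarrow>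
     e \<noteq> e' \<and> e \<noteq> e'' \<and> e' \<noteq> e'' \<and>
       ((a = a' \<or> a = b') \<and> (a = a'' \<or> a = b'') \<or> (b = a' \<or> b = b') \<and> (b = a'' \<or> b = b''))))"

text \<open>The incidence vectors are pairwise distinct, so the third edge of a cut is found from
  the sum of the other two vectors, and the check runs over pairs instead of triples.\<close>

definition check_table :: "(bool list \<times> nat \<times> nat \<times> nat) list \<Rightarrow> bool" where
  "check_table T = list_all (\<lambda>(x, u). list_all (\<lambda>(y, v). closes u v (map_of T (map2 (\<noteq>) x y))) T) T"

lemma inc_table_eq: "inc_table = 
    [([False, False, False, False, False, False, False, False, False, True], 0, 0, 1),
     ([False, False, False, False, False, False, False, False, True, False], 1, 0, 12),
     ([False, False, False, False, False, False, False, False, True, True], 2, 0, 16),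
     ([True, False, False, False, False, False, False, False, False, True], 3, 1, 2),
     ([True, False, False, False, False, False, False, False, False, False], 4, 1, 3),
     ([False, False, False, False, True, False, True, False, False, True], 5, 2, 4),
     ([True, False, False, False, True, False, True, False, False, False], 6, 2, 5),
     ([True, False, False, False, False, False, False, True, False, False], 7, 3, 6),
     ([False, False, False, False, True, False, False, False, False, True], 8, 4, 7),
     ([True, False, False, False, False, True, False, True, False, False], 9, 5, 6),
     ([False, False, False, False, True, True, True, True, False, False], 10, 5, 8),
     ([False, False, False, False, False, True, False, False, False, False], 11, 6, 9),
     ([False, True, False, False, True, False, False, False, False, False], 12, 7, 10),
     ([False, True, False, False, False, False, False, False, False, True], 13, 7, 11),
     ([False, False, False, False, True, True, False, False, False, False], 14, 8, 10),
     ([False, False, True, False, False, False, False, False, True, False], 15, 9, 12),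
     ([False, False, True, False, False, True, False, False, True, False], 16, 9, 13),
     ([False, True, False, False, False, True, False, False, False, False], 17, 10, 14),
     ([False, True, False, True, False, False, False, False, False, False], 18, 11, 15),
     ([False, False, False, True, False, False, False, False, False, True], 19, 11, 16),
     ([False, False, True, False, False, False, False, False, False, False], 20, 12, 15),
     ([False, False, True, True, False, True, False, False, False, False], 21, 13, 14),
     ([False, False, False, True, False, False, False, False, True, False], 22, 13, 16),
     ([False, True, True, True, False, False, False, False, False, False], 23, 14, 15),
     ([False, False, False, False, False, False, False, True, False, False], 24, 3, 17),
     ([False, False, False, False, False, False, True, False, False, False], 25, 4, 17),
     ([False, False, False, False, False, False, True, True, False, False], 26, 8, 17)]"
  by code_simp

lemma check_inc_table: "check_table inc_table"
  unfolding inc_table_eq by code_simp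

lemma distinct_inc_table: "distinct (map fst inc_table)"
  unfolding inc_table_eq by code_simp

text \<open>This is where cyclic 4-edge-connectivity enters. The triple is orthogonal to the
  generating cycles, so the table yields three distinct edges with a common end, and a star has only
  three edges.\<close>

lemma star_of_triple:
  assumes "e < 27" "e' < 27" "e'' < 27"
    and inner: "\<And>C. C \<in> set inner_cycles \<Longrightarrow> (e'' \<in> set C) = ((e \<in> set C) \<noteq> (e' \<in> set C))"
    and right: "\<And>p. p < 3 \<Longrightarrow> (e'' \<in> set (right_cycle p)) =
      ((e \<in> set (right_cycle p)) \<noteq> (e' \<in> set (right_cycle p)))"
    and left: "\<And>p. p < 3 \<Longrightarrow> (e'' \<in> set (left_cycle p)) =
      ((e \<in> set (left_cycle p)) \<noteq> (e' \<in> set (left_cycle p)))"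
  obtains a where "a < 18" "star a = {e, e', e''}"
proof -
  have sum: "inc e'' = map2 (\<noteq>) (inc e) (inc e')"
    unfolding inc_def map2_map_map using inner right left by (intro map_cong refl) auto
  have mem: "(inc e, e, lo e, hi e) \<in> set inc_table" if "e < 27" for e
    using that by (auto simp: inc_table_def)
  have "map_of inc_table (inc e'') = Some (e'', lo e'', hi e'')"
    using distinct_inc_table mem[OF assms(3)] by (rule map_of_is_SomeI)
  moreover have "closes (e, lo e, hi e) (e', lo e', hi e')
      (map_of inc_table (map2 (\<noteq>) (inc e) (inc e')))"
    using bspec[OF bspec[OF check_inc_table[unfolded check_table_def list_all_iff] mem[OF assms(1)],
        unfolded prod.case] mem[OF assms(2)]]
    unfolding prod.case .
  ultimately have "closes (e, lo e, hi e) (e', lo e', hi e') (Some (e'', lo e'', hi e''))"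
    unfolding sum by simp
  then have d: "e \<noteq> e'" "e \<noteq> e''" "e' \<noteq> e''" and "\<exists>a\<in>{lo e, hi e}. {e, e', e''} \<subseteq> star a"
    using assms(1-3) by (auto simp: closes_def in_star_iff)
  then obtain a where a: "a \<in> {lo e, hi e}" "{e, e', e''} \<subseteq> star a" by blast
  then have "a < 18"
    using snark_ends[OF assms(1)] by auto
  moreover from this have "{e, e', e''} = star a"
    using a(2) d by (intro card_subset_eq) (auto simp: card_star)
  ultimately show thesis by (rule that[OF _ sym])
qed

section \<open>Adjacency and pentagons in the snark\<close>

text \<open>Adjacency is phrased through stars because stars are what the maps are known to
  preserve.\<close>

definition nbs :: "nat \<Rightarrow> nat set" where
  "nbs a = {b. b \<noteq> a \<and> star a \<inter> star b \<noteq> {}}"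

lemma nbs_eq:
  assumes "a < 18"
  shows "nbs a = set (map (\<lambda>e. if lo e = a then hi e else lo e) (star_list a))"
  unfolding set_map star_def[symmetric]
proof (intro equalityI subsetI)
  fix b assume "b \<in> nbs a"
  then obtain e where "e \<in> star a" "e \<in> star b" "b \<noteq> a" by (auto simp: nbs_def)
  then show "b \<in> (\<lambda>e. if lo e = a then hi e else lo e) ` star a"
    by (intro image_eqI[of _ _ e]) (auto simp: in_star_iff)
next
  fix b assume "b \<in> (\<lambda>e. if lo e = a then hi e else lo e) ` star a"
  then obtain e where "e \<in> star a" "b = (if lo e = a then hi e else lo e)" by blast
  then have "e \<in> star a \<inter> star b" "b \<noteq> a"
    using snark_ends(1)[of e] by (auto simp: in_star_iff split: if_splits)
  then show "b \<in> nbs a"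
    unfolding nbs_def by blast
qed

lemma nbs_simps:
    "nbs 0 = {1, 12, 16}"
    "nbs (Suc 0) = {0, 2, 3}"
    "nbs 2 = {1, 4, 5}"
    "nbs 3 = {1, 6, 17}"
    "nbs 4 = {2, 7, 17}"
    "nbs 5 = {2, 6, 8}"
    "nbs 6 = {3, 5, 9}"
    "nbs 7 = {4, 10, 11}"
    "nbs 8 = {5, 10, 17}"
    "nbs 9 = {6, 12, 13}"
    "nbs 10 = {7, 8, 14}"
    "nbs 11 = {7, 15, 16}"
    "nbs 12 = {0, 9, 15}"
    "nbs 13 = {9, 14, 16}"
    "nbs 14 = {10, 13, 15}"
    "nbs 15 = {11, 12, 14}"
    "nbs 16 = {0, 11, 13}"
    "nbs 17 = {3, 4, 8}"
  by (simp_all add: nbs_eq)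

text \<open>Two neighbours of \<open>a\<close> joined by a walk of length three lie on a common pentagon with \<open>a\<close>,
  as the snark has girth five.\<close>

definition pentagonal :: "nat \<Rightarrow> bool" where
  "pentagonal a \<longleftrightarrow> (\<forall>b\<in>nbs a. \<forall>c\<in>nbs a. b \<noteq> c \<longrightarrow> (\<exists>p\<in>nbs b. \<exists>q\<in>nbs c. p \<in> nbs q))"

text \<open>These values tell the ends 0 and 17 apart and mark one edge at each: 1 is the only
  neighbour of 0 that is not pentagonal, and 3 is the only neighbour of 17 that is.\<close>

lemma pentagonal_simps:
  "\<not> pentagonal 0" "pentagonal 17" "\<not> pentagonal 1" "pentagonal 12" "pentagonal 16"
  "pentagonal 3" "\<not> pentagonal 4" "\<not> pentagonal 8"
  unfolding pentagonal_def by (simp_all add: nbs_simps)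

subsection \<open>Chains of snarks\<close>

text \<open>If \<open>e\<close> were a bridge, let \<open>A\<close> be the component of one end
  after its deletion. The degrees in \<open>C\<close> over \<open>A\<close> have an even sum, yet
  \<open>e\<close> contributes one to it and every other edge of \<open>C\<close> contributes zero
  or two.\<close>

lemma even_degree_not_bridge:
  assumes "fin_multigraph G" "is_cycle G C" "e \<in> C"
  shows "\<not> bridge G e"
proof
  interpret fin_multigraph G by fact
  assume "bridge G e"
  then obtain u v where uv: "ends G e = {#u, v#}" "\<not> connected_in (delete_edge G e) u v"
    by (auto simp: bridge_def)
  have C: "C \<subseteq> edges G" "\<And>x. x \<in> verts G \<Longrightarrow> even (degree_in G C x)"
    using assms by (auto simp: is_cycle_def)
  have finC: "finite C"
    using C(1) finite_edges finite_subset by blast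
  define A where "A = {x \<in> verts G. connected_in (delete_edge G e) u x}"
  have finA: "finite A"
    by (simp add: A_def finite_verts)
  have u: "u \<in> A"
    using ends_in_verts[of e] assms(3) C(1) uv(1) by (auto simp: A_def connected_in_def)
  have v: "v \<notin> A"
    using uv(2) by (simp add: A_def)
  define d where "d e' = (\<Sum>x\<in>A. count (ends G e') x)" for e'
  have d: "d e' = of_bool (x \<in> A) + of_bool (y \<in> A)" if "ends G e' = {#x, y#}" for e' x y
  proof -
    have "d e' = (\<Sum>z\<in>A. (if z = x then 1 else 0) + (if z = y then 1 else 0))"
      unfolding d_def that by (intro sum.cong) auto
    also have "\<dots> = of_bool (x \<in> A) + of_bool (y \<in> A)"
      using finA by (simp add: sum.distrib)
    finally show ?thesis .
  qed
  have "even (d e')" if e': "e' \<in> C - {e}" for e'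
  proof -
    have "size (ends G e') = 2"
      using e' C(1) size_ends by blast
    then have "size (ends G e') = Suc (Suc 0)" by simp
    then obtain x N where x: "ends G e' = add_mset x N"
      using size_eq_Suc_imp_eq_union by blast
    with \<open>size (ends G e') = Suc (Suc 0)\<close> have "size N = Suc 0" by simp
    then obtain y where "N = {#y#}"
      using size_eq_Suc_imp_eq_union[of N 0] by auto
    with x have xy: "ends G e' = {#x, y#}" by simp
    then have "x \<in> verts G" "y \<in> verts G"
      using ends_in_verts[of e'] e' C(1) by auto
    moreover have "e' \<in> edges (delete_edge G e)" "ends (delete_edge G e) e' = {#x, y#}"
      using xy e' C(1) by (auto simp: delete_edge_def)
    then have "(x, y) \<in> adjacency (delete_edge G e)" "(y, x) \<in> adjacency (delete_edge G e)"
      unfolding adjacency_def by (auto simp: add_mset_commute)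
    ultimately have "x \<in> A \<longleftrightarrow> y \<in> A"
      unfolding A_def connected_in_def by (auto intro: rtrancl_into_rtrancl)
    then show ?thesis
      using d[OF xy] by auto
  qed
  then have "even (sum d (C - {e}))"
    by (rule dvd_sum)
  moreover have "d e = 1"
    using d[OF uv(1)] u v by simp
  ultimately have "odd (sum d C)"
    using finC assms(3) by (simp add: sum.remove)
  moreover have "sum d C = (\<Sum>x\<in>A. degree_in G C x)"
    unfolding d_def degree_in_def by (rule sum.swap)
  moreover have "even (\<Sum>x\<in>A. degree_in G C x)"
    by (rule dvd_sum) (use C(2) A_def in auto)
  ultimately show False by simp
qed

section \<open>Construction of the chain\<close>

definition swap01 :: "nat \<Rightarrow> nat" where
  "swap01 e = (if e = 0 then 1 else if e = 1 then 0 else e)"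

text \<open>Piece \<open>j\<close> of a chain occupies the edges \<open>24 * j\<close> to \<open>24 * j + 26\<close>, the last three of
  which are also the first three of piece \<open>j + 1\<close>; this gluing is twisted by a transposition when
  \<open>w (j + 1)\<close> holds. Star \<open>17 * j + a\<close> is that of vertex \<open>a\<close> of piece \<open>j\<close>; since vertex 17 of
  piece \<open>j\<close> and vertex 0 of piece \<open>j + 1\<close> are removed by the gluing, the star \<open>17 * (j + 1)\<close> is
  virtual, a cut of three edges.\<close>

definition emb :: "(nat \<Rightarrow> bool) \<Rightarrow> nat \<Rightarrow> nat \<Rightarrow> nat" where
  "emb w j e = 24 * j + (if e < 3 \<and> w j then swap01 e else e)"

definition chain_star :: "(nat \<Rightarrow> bool) \<Rightarrow> nat \<Rightarrow> nat set" where
  "chain_star w s = emb w (s div 17) ` star (s mod 17)"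

definition chain :: "(nat \<Rightarrow> bool) \<Rightarrow> nat \<Rightarrow> (nat, nat) multigraph" where
  "chain w n = (let V = {s. s \<le> 17 * n \<and> (17 dvd s \<longrightarrow> s = 0 \<or> s = 17 * n)} in
     \<lparr>verts = V, edges = {..<24 * n + 3}, ends = (\<lambda>g. mset_set {s \<in> V. g \<in> chain_star w s})\<rparr>)"

lemma swap01_less_3 [simp]: "swap01 e < 3 \<longleftrightarrow> e < 3"
  by (auto simp: swap01_def)

lemma swap01_swap01 [simp]: "swap01 (swap01 e) = e"
  by (auto simp: swap01_def)

lemma swap01_eq_iff [simp]: "swap01 e = swap01 e' \<longleftrightarrow> e = e'"
  by (metis swap01_swap01)

text \<open>Pieces overlap only in the three edges of a common join, where the two addresses of an
  edge differ by 24 and the twist.\<close>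

lemma emb_eq_iff:
  assumes "e < 27" "e' < 27"
  shows "emb w j e = emb w j' e' \<longleftrightarrow> j = j' \<and> e = e' \<or>
    j' = Suc j \<and> e' < 3 \<and> e = 24 + (if w j' then swap01 e' else e') \<or>
    j = Suc j' \<and> e < 3 \<and> e' = 24 + (if w j then swap01 e else e)"
proof -
  define x where "x = (if e < 3 \<and> w j then swap01 e else e)"
  define x' where "x' = (if e' < 3 \<and> w j' then swap01 e' else e')"
  have x: "x < 27" "x' < 27" "x < 3 \<longleftrightarrow> e < 3" "x' < 3 \<longleftrightarrow> e' < 3" "\<not> e < 3 \<Longrightarrow> x = e" "\<not> e' < 3 \<Longrightarrow> x' = e'"
    using assms swap01_less_3[of e] swap01_less_3[of e'] by (auto simp: x_def x'_def simp del: swap01_less_3)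
  have "emb w j e = emb w j' e' \<longleftrightarrow> 24 * j + x = 24 * j' + x'"
    by (simp add: emb_def x_def x'_def)
  also have "\<dots> \<longleftrightarrow> j = j' \<and> x = x' \<or> j' = Suc j \<and> x' < 3 \<and> x = 24 + x' \<or> j = Suc j' \<and> x < 3 \<and> x' = 24 + x"
  proof
    assume eq: "24 * j + x = 24 * j' + x'"
    then have "j' \<le> Suc j" "j \<le> Suc j'"
      using x(1,2) by linarith+
    then consider "j = j'" | "j' = Suc j" | "j = Suc j'" by linarith
    then show "j = j' \<and> x = x' \<or> j' = Suc j \<and> x' < 3 \<and> x = 24 + x' \<or> j = Suc j' \<and> x < 3 \<and> x' = 24 + x"
      using eq x(1,2) by cases auto
  qed auto
  also have "\<dots> \<longleftrightarrow> j = j' \<and> e = e' \<or>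
    j' = Suc j \<and> e' < 3 \<and> e = 24 + (if w j' then swap01 e' else e') \<or>
    j = Suc j' \<and> e < 3 \<and> e' = 24 + (if w j then swap01 e else e)"
  proof -
    have "j = j' \<and> x = x' \<longleftrightarrow> j = j' \<and> e = e'"
      by (cases "e < 3"; cases "e' < 3") (use x(3-6) in \<open>auto simp: x_def x'_def\<close>)
    moreover have "x = 24 + x' \<longleftrightarrow> e = 24 + x'" "x' = 24 + x \<longleftrightarrow> e' = 24 + x"
      using x(3-6) by (cases "e < 3"; cases "e' < 3"; simp)+
    ultimately show ?thesis
      using x(3,4) by (auto simp: x_def x'_def)
  qed
  finally show ?thesis .
qed

lemma inj_on_emb: "inj_on (emb w j) {..<27}"
  by (auto simp: inj_on_def emb_eq_iff)

lemma emb_bounds: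
  assumes "e < 27"
  shows "24 * j \<le> emb w j e" "emb w j e < 24 * j + 27" "emb w j e < 24 * j + 3 \<longleftrightarrow> e < 3"
    "3 \<le> e \<Longrightarrow> emb w j e = 24 * j + e"
  using assms swap01_less_3[of e] by (auto simp: emb_def simp del: swap01_less_3)

lemma emb_image_left: "emb w j ` {..<3} = {24 * j..<24 * j + 3}"
proof (rule card_subset_eq)
  show "emb w j ` {..<3} \<subseteq> {24 * j..<24 * j + 3}"
    using emb_bounds[where w = w and j = j] by auto
  have "inj_on (emb w j) {..<3}"
    by (rule inj_on_subset[OF inj_on_emb]) auto
  then show "card (emb w j ` {..<3}) = card {24 * j..<24 * j + 3}"
    by (simp add: card_image)
qed simp

text \<open>For \<open>a = 17\<close> the star is by definition that of vertex 0 in the next piece.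
  Both descriptions give the same three edges because the twist only permutes them.\<close>

lemma chain_star_eq:
  assumes "a < 18"
  shows "chain_star w (17 * j + a) = emb w j ` star a"
proof (cases "a = 17")
  case True
  have "emb w j ` {24..<27} = {24 * Suc j..<24 * Suc j + 3}"
  proof (intro equalityI subsetI)
    fix g assume "g \<in> {24 * Suc j..<24 * Suc j + 3}"
    then show "g \<in> emb w j ` {24..<27}"
      by (intro image_eqI[of _ _ "g - 24 * j"]) (auto simp: emb_def)
  qed (auto simp: emb_def)
  moreover have "chain_star w (17 * j + a) = emb w (Suc j) ` star 0"
    using True by (simp add: chain_star_def)
  ultimately show ?thesis
    using True emb_image_left[of w "Suc j"] by (simp add: star_0 star_17)
next
  case False
  then show ?thesis
    using assms by (simp add: chain_star_def)
qed

lemma chain_star_cases: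
  fixes n :: nat
  assumes "s \<le> 17 * n" "0 < n"
  obtains j a where "j < n" "a < 18" "s = 17 * j + a"
proof (cases "s = 17 * n")
  case True
  then have "s = 17 * (n - 1) + 17" using assms by (cases n) auto
  then show thesis using that[of "n - 1" 17] assms by simp
next
  case False
  then have "s div 17 < n" using assms by auto
  then show thesis using that[of "s div 17" "s mod 17"] by auto
qed

lemma star_subset: "star a \<subseteq> {..<27}"
  by (auto simp: in_star_iff)

lemma finite_chain_star [simp]: "finite (chain_star w s)"
  by (simp add: chain_star_def)

lemma card_chain_star: "card (chain_star w s) = 3"
  unfolding chain_star_def
  by (subst card_image[OF inj_on_subset[OF inj_on_emb star_subset]]) (auto intro: card_star)

lemma chain_star_subset: assumes "s \<le> 17 * n" shows "chain_star w s \<subseteq> {..<24 * n + 3}"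
proof (cases "n = 0")
  case True
  then show ?thesis
    using assms emb_image_left[of w 0] by (auto simp: chain_star_def star_0)
next
  case False
  then obtain j a where j: "j < n" "a < 18" "s = 17 * j + a"
    using assms chain_star_cases by blast
  have "emb w j e < 24 * n + 3" if "e < 27" for e
    using emb_bounds(2)[OF that, where w = w and j = j] j(1) by simp
  then show ?thesis
    using star_subset j by (auto simp: chain_star_eq)
qed

lemma mem_chain_star_iff:
  assumes "e < 24"
  shows "emb w j e \<in> chain_star w s \<longleftrightarrow> s = 17 * j + lo e \<or> s = 17 * j + hi e \<or>
    e < 3 \<and> (\<exists>i. j = Suc i \<and> s = 17 * i + lo (24 + (if w j then swap01 e else e)))"
proof -
  define i a where "i = s div 17" and "a = s mod 17"
  have s: "s = 17 * i + a" "a < 17"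
    by (auto simp: i_def a_def)
  define t where "t = 24 + (if w j then swap01 e else e)"
  have "24 \<le> t"
    by (simp add: t_def)
  have t: "t < 27" if "e < 3"
    using that swap01_less_3[of e] by (auto simp: t_def simp del: swap01_less_3)
  have "emb w j e \<in> chain_star w s \<longleftrightarrow> (\<exists>e'\<in>star a. emb w j e = emb w i e')"
    unfolding s(1) using s(2) by (subst chain_star_eq) auto
  also have "\<dots> \<longleftrightarrow> i = j \<and> e \<in> star a \<or> j = Suc i \<and> e < 3 \<and> t \<in> star a"
    using assms t by (auto simp: in_star_iff emb_eq_iff simp flip: t_def)
  also have "\<dots> \<longleftrightarrow> i = j \<and> (a = lo e \<or> a = hi e) \<or> j = Suc i \<and> e < 3 \<and> a = lo t"
    using assms t \<open>24 \<le> t\<close> snark_ends(6)[of t] s(2) by (auto simp: in_star_iff)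
  also have "\<dots> \<longleftrightarrow> s = 17 * j + lo e \<or> s = 17 * j + hi e \<or>
    e < 3 \<and> (\<exists>i. j = Suc i \<and> s = 17 * i + lo t)"
  proof -
    have lt: "lo e < 17" "hi e < 17"
      using snark_ends(1,5)[of e] assms by auto
    have lt': "lo t < 17" if "e < 3"
      using t[OF that] \<open>24 \<le> t\<close> snark_ends(1,6)[of t] by auto
    have *: "s = 17 * k + b \<longleftrightarrow> i = k \<and> a = b" if "b < 17" for k b
      unfolding i_def a_def using that by auto
    show ?thesis
      by (cases "e < 3") (auto simp: *[OF lt(1)] *[OF lt(2)] *[OF lt'])
  qed
  finally show ?thesis unfolding t_def .
qed

lemma chain_simps:
  "verts (chain w n) = {s. s \<le> 17 * n \<and> (17 dvd s \<longrightarrow> s = 0 \<or> s = 17 * n)}"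
  "edges (chain w n) = {..<24 * n + 3}"
  "ends (chain w n) g = mset_set {s \<in> verts (chain w n). g \<in> chain_star w s}"
  by (simp_all add: chain_def Let_def)

lemma finite_verts_chain: "finite (verts (chain w n))"
  by (rule finite_subset[of _ "{..17 * n}"]) (auto simp: chain_simps)

lemma degree_in_chain:
  assumes "finite C" "s \<in> verts (chain w n)"
  shows "degree_in (chain w n) C s = card (C \<inter> chain_star w s)"
proof -
  have "degree_in (chain w n) C s = (\<Sum>g\<in>C. of_bool (g \<in> chain_star w s))"
    unfolding degree_in_def using assms(2) finite_verts_chain[of w n]
    by (intro sum.cong) (auto simp: chain_simps(3) count_mset_set')
  then show ?thesis
    using assms(1) by (simp add: Int_def flip: Collect_conj_eq)
qed

lemma card_ends_chain:
  assumes "g < 24 * n + 3" "0 < n"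
  shows "card {s \<in> verts (chain w n). g \<in> chain_star w s} = 2"
proof -
  let ?V = "\<lambda>g. {s \<in> verts (chain w n). g \<in> chain_star w s}"
  obtain j e where g: "j \<le> n" "e < 24" "g = emb w j e" "j = n \<longrightarrow> e < 3"
  proof -
    \<comment> \<open>The address is taken in the piece where the edge is among the first 24. For
      the right free end this is the fictitious piece \<open>n\<close>, with address below
      3.\<close>
    define e where "e = (if g mod 24 < 3 \<and> w (g div 24) then swap01 (g mod 24) else g mod 24)"
    have "e < 3 \<longleftrightarrow> g mod 24 < 3" "e < 24"
      using swap01_less_3[of "g mod 24"] by (auto simp: e_def simp del: swap01_less_3)
    moreover have "g div 24 \<le> n" "g div 24 = n \<longrightarrow> g mod 24 < 3"
      using assms(1) by presburger+
    moreover have "g = emb w (g div 24) e"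
      by (auto simp: emb_def e_def)
    ultimately show thesis
      by (intro that[of "g div 24" e]) simp_all
  qed
  let ?t = "24 + (if w j then swap01 e else e)"
  have e: "lo e < hi e" "hi e \<le> 16" "e < 3 \<Longrightarrow> lo e = 0" "3 \<le> e \<Longrightarrow> 1 \<le> lo e"
    using snark_ends[of e] g(2) by auto
  have t: "1 \<le> lo ?t" "lo ?t \<le> 16" if "e < 3"
    using that snark_ends(1,4,6)[of ?t] swap01_less_3[of e] by (auto simp del: swap01_less_3)
  have mult: "17 dvd 17 * k + b \<longleftrightarrow> b = 0" if "b < 17" for k b :: nat
    using that by (simp add: dvd_eq_mod_eq_0)
  \<comment> \<open>The four kinds of edges: interior edge, left free end, genuine join, right free
    end. At a genuine join the star \<open>17 * j\<close> is virtual, so the ends are the outer ends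
    of the two glued edges, the left one having address \<open>?t\<close>.\<close>
  consider "3 \<le> e" | "e < 3" "j = 0" | "e < 3" "0 < j" "j < n" | "e < 3" "j = n" "0 < j"
    using g assms(2) by linarith
  then show ?thesis
  proof cases
    case 1
    then have "?V g = {17 * j + lo e, 17 * j + hi e}"
      using g e mult[of "lo e" j] mult[of "hi e" j]
      by (auto simp: mem_chain_star_iff chain_simps)
    then show ?thesis using e by simp
  next
    case 2
    then have "?V g = {0, hi e}"
      using g e assms(2) mult[of "hi e" 0]
      by (auto simp: mem_chain_star_iff chain_simps)
    then show ?thesis using e 2 by simp
  next
    case 3
    then obtain i where i: "j = Suc i" by (cases j) auto
    have "?V g = {17 * j + hi e, 17 * i + lo ?t}"
      using 3 g e t i mult[of "hi e" j] mult[of "lo ?t" i] mult[of 0 j]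
      by (auto simp: mem_chain_star_iff chain_simps)
    moreover have "17 * i + lo ?t < 17 * j + hi e" 
      using e t[OF 3(1)] i by simp
    ultimately show ?thesis by simp
  next
    case 4
    then obtain i where i: "j = Suc i" by (cases j) auto
    have "?V g = {17 * j, 17 * i + lo ?t}"
      using 4 g e t i mult[of "hi e" j] mult[of "lo ?t" i] mult[of 0 j]
      by (auto simp: mem_chain_star_iff chain_simps)
    moreover have "17 * i + lo ?t < 17 * j"
      using t[OF 4(1)] i by simp
    ultimately show ?thesis by simp
  qed
qed

lemma fin_multigraph_chain:
  assumes "0 < n"
  shows "fin_multigraph (chain w n)"
proof
  show "finite (verts (chain w n))" by (rule finite_verts_chain)
  show "finite (edges (chain w n))" by (simp add: chain_simps)
  show "size (ends (chain w n) e) = 2" if "e \<in> edges (chain w n)" for e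
    using card_ends_chain[of e n w] that assms by (simp add: chain_simps)
  show "set_mset (ends (chain w n) e) \<subseteq> verts (chain w n)" for e
    using finite_verts_chain[of w n] by (simp add: chain_simps(3))
qed

lemma cubic_chain: "cubic (chain w n)"
proof -
  have "edges (chain w n) \<inter> chain_star w s = chain_star w s" if "s \<in> verts (chain w n)" for s
    using chain_star_subset[of s n w] that by (auto simp: chain_simps)
  then show ?thesis
    by (simp add: cubic_def degree_in_chain card_chain_star chain_simps(2))
qed

section \<open>Cycles of a chain seen from its pieces\<close>

lemma card_Int_chain_star:
  assumes "a < 18"
  shows "card (C \<inter> chain_star w (17 * j + a)) = card ({e. e < 27 \<and> emb w j e \<in> C} \<inter> star a)"
proof -
  have "C \<inter> chain_star w (17 * j + a) = emb w j ` ({e. e < 27 \<and> emb w j e \<in> C} \<inter> star a)"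
    using assms by (auto simp: chain_star_eq in_star_iff)
  moreover have "inj_on (emb w j) ({e. e < 27 \<and> emb w j e \<in> C} \<inter> star a)"
    by (rule inj_on_subset[OF inj_on_emb]) auto
  ultimately show ?thesis by (simp add: card_image)
qed

lemma is_cycle_chainI:
  assumes "0 < n" "C \<subseteq> {..<24 * n + 3}"
    and "\<And>j a. j < n \<Longrightarrow> a < 18 \<Longrightarrow> even (card ({e. e < 27 \<and> emb w j e \<in> C} \<inter> star a))"
  shows "is_cycle (chain w n) C"
  unfolding is_cycle_def
proof (intro conjI ballI)
  show "C \<subseteq> edges (chain w n)" using assms by (simp add: chain_simps)
  fix s assume s: "s \<in> verts (chain w n)"
  then obtain j a where "j < n" "a < 18" "s = 17 * j + a"
    using assms(1) chain_star_cases[of s n] by (auto simp: chain_simps)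
  moreover have "finite C" using assms(2) finite_subset by blast
  ultimately show "even (degree_in (chain w n) C s)"
    using assms(3) s by (simp add: degree_in_chain card_Int_chain_star)
qed

text \<open>The three edges shared by consecutive pieces form a cut, so that a cycle meets also these
  virtual stars evenly.\<close>

lemma is_cycle_chain_even:
  assumes "is_cycle (chain w n) C" "s \<le> 17 * n"
  shows "even (card (C \<inter> chain_star w s))"
proof -
  have fin: "finite C"
    using assms(1) finite_subset[of C "{..<24 * n + 3}"] by (auto simp: is_cycle_def chain_simps)
  have real_star: "even (card (C \<inter> chain_star w s))" if "s \<in> verts (chain w n)" for s
    using assms(1) that degree_in_chain[OF fin that] by (auto simp: is_cycle_def)
  have interior: "even (card (C \<inter> chain_star w (17 * j + a)))" if "j < n" "1 \<le> a" "a \<le> 16" for j a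
  proof (rule real_star)
    have "\<not> 17 dvd 17 * j + a" using that by (simp add: dvd_eq_mod_eq_0)
    then show "17 * j + a \<in> verts (chain w n)" using that by (simp add: chain_simps)
  qed
  have joins: "even (card (C \<inter> chain_star w (17 * j)))" if "j \<le> n" for j
    using that
  proof (induction j)
    case 0
    then show ?case using real_star[of 0] by (simp add: chain_simps)
  next
    case (Suc j)
    let ?D = "{e. e < 27 \<and> emb w j e \<in> C}"
    \<comment> \<open>The sum over the piece is even by double counting, and all its stars but that
      of vertex 17 are already known to be met evenly.\<close>
    have "(\<Sum>a<18. card (?D \<inter> star a)) = (\<Sum>a<17. card (?D \<inter> star a)) + card (?D \<inter> star 17)"
      using sum.lessThan_Suc[of "\<lambda>a. card (?D \<inter> star a)" 17] by simp
    moreover have "even (\<Sum>a<18. card (?D \<inter> star a))"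
      by (subst handshake) auto
    moreover have "even (\<Sum>a<17. card (?D \<inter> star a))"
    proof (rule dvd_sum)
      fix a :: nat assume "a \<in> {..<17}"
      then have "even (card (C \<inter> chain_star w (17 * j + a)))"
        using Suc interior[of j a] by (cases "a = 0") auto
      then show "even (card (?D \<inter> star a))"
        using card_Int_chain_star[of a C w j] \<open>a \<in> {..<17}\<close> by simp
    qed
    ultimately have "even (card (?D \<inter> star 17))"
      by simp
    then show ?case
      using card_Int_chain_star[of 17 C w j] by (simp add: add.commute)
  qed
  show ?thesis
  proof (cases "n = 0")
    case True
    then show ?thesis using joins[of 0] assms(2) by simp
  next
    case False
    then obtain j a where "j < n" "a < 18" "s = 17 * j + a"
      using assms(2) chain_star_cases by blast
    moreover have "a = 0 \<or> a = 17 \<or> 1 \<le> a \<and> a \<le> 16"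
      using \<open>a < 18\<close> by linarith
    ultimately show ?thesis
      using joins[of j] joins[of "Suc j"] interior[of j a] by (auto simp: add.commute)
  qed
qed

subsection \<open>Three-edge cuts of a chain\<close>

lemma mem_inner_image_iff:
  assumes "I \<subseteq> {3..<24}" "e < 27"
  shows "emb w j e \<in> emb w i ` I \<longleftrightarrow> j = i \<and> e \<in> I"
proof -
  have "emb w j e \<in> emb w i ` I \<longleftrightarrow> (\<exists>e'\<in>I. emb w j e = emb w i e')" by auto
  also have "\<dots> \<longleftrightarrow> (\<exists>e'\<in>I. j = i \<and> e = e')"
    using assms by (intro bex_cong refl) (auto simp: emb_eq_iff)
  finally show ?thesis by auto
qed

text \<open>A cycle crossing one join, glued from a half on each side. The left half omits end edge
  \<open>p\<close>; the right half must omit the edge glued to it, hence the twist. At a free end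
  only one half exists.\<close>

definition join_cycle :: "(nat \<Rightarrow> bool) \<Rightarrow> nat \<Rightarrow> nat \<Rightarrow> nat \<Rightarrow> nat set" where
  "join_cycle w n i p =
     (if 0 < i then emb w (i - 1) ` set (right_cycle p) else {}) \<union>
     (if i < n then emb w i ` set (left_cycle (if w i then swap01 p else p)) else {})"

lemma mem_right_image_iff:
  assumes "p < 3" "e < 27"
  shows "emb w j e \<in> emb w k ` set (right_cycle p) \<longleftrightarrow>
    j = k \<and> e \<in> set (right_cycle p) \<or> j = Suc k \<and> e < 3 \<and> (if w j then swap01 e else e) \<noteq> p"
proof -
  have "emb w j e \<in> emb w k ` set (right_cycle p) \<longleftrightarrow>
      (\<exists>e'\<in>set (right_cycle p). emb w j e = emb w k e')" by auto
  also have "\<dots> \<longleftrightarrow> (\<exists>e'\<in>set (right_cycle p). j = k \<and> e = e' \<or>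
      j = Suc k \<and> e < 3 \<and> e' = 24 + (if w j then swap01 e else e))"
    using assms right_cycle_subset[of p] by (intro bex_cong refl) (auto simp: emb_eq_iff)
  also have "\<dots> \<longleftrightarrow> j = k \<and> e \<in> set (right_cycle p) \<or>
      j = Suc k \<and> e < 3 \<and> 24 + (if w j then swap01 e else e) \<in> set (right_cycle p)"
    by auto
  finally show ?thesis
    using right_cycle_end[OF assms(1), of "if w j then swap01 e else e"] by auto
qed

lemma mem_left_image_iff:
  assumes "p < 3" "e < 27"
  shows "emb w j e \<in> emb w i ` set (left_cycle (if w i then swap01 p else p)) \<longleftrightarrow>
    j = i \<and> e \<in> set (left_cycle (if w i then swap01 p else p)) \<or>
    i = Suc j \<and> 24 \<le> e \<and> e \<noteq> 24 + p"
proof -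
  let ?t = "\<lambda>e. if w i then swap01 e else e"
  have p: "?t p < 3" using assms by auto
  have "emb w j e \<in> emb w i ` set (left_cycle (?t p)) \<longleftrightarrow>
      (\<exists>e'\<in>set (left_cycle (?t p)). emb w j e = emb w i e')" by auto
  also have "\<dots> \<longleftrightarrow> (\<exists>e'\<in>set (left_cycle (?t p)). j = i \<and> e = e' \<or>
      i = Suc j \<and> e' < 3 \<and> e = 24 + ?t e')"
    using assms left_cycle_subset[OF p] by (intro bex_cong refl) (auto simp: emb_eq_iff)
  also have "\<dots> \<longleftrightarrow> j = i \<and> e \<in> set (left_cycle (?t p)) \<or>
      i = Suc j \<and> (\<exists>e'<3. e' \<in> set (left_cycle (?t p)) \<and> e = 24 + ?t e')"
    by blast
  also have "(\<exists>e'<3. e' \<in> set (left_cycle (?t p)) \<and> e = 24 + ?t e') \<longleftrightarrow>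
      (\<exists>e'<3. e' \<noteq> ?t p \<and> e = 24 + ?t e')"
    using left_cycle_end[OF p] by blast
  also have "\<dots> \<longleftrightarrow> 24 \<le> e \<and> e \<noteq> 24 + p"
  proof
    assume "24 \<le> e \<and> e \<noteq> 24 + p"
    then show "\<exists>e'<3. e' \<noteq> ?t p \<and> e = 24 + ?t e'"
      using assms(2) by (intro exI[of _ "?t (e - 24)"]) auto
  next
    assume "\<exists>e'<3. e' \<noteq> ?t p \<and> e = 24 + ?t e'"
    then show "24 \<le> e \<and> e \<noteq> 24 + p"
      by (cases "w i") auto
  qed
  finally show ?thesis .
qed

text \<open>On the shared edges both halves agree, so within one piece only the half belonging to
  that piece is visible.\<close>

lemma mem_join_cycle_iff:
  assumes "p < 3" "e < 27" "j < n"
  shows "emb w j e \<in> join_cycle w n i p \<longleftrightarrow>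
    i = Suc j \<and> e \<in> set (right_cycle p) \<or>
    i = j \<and> e \<in> set (left_cycle (if w i then swap01 p else p))"
proof -
  have R: "e \<in> set (right_cycle p)" if "24 \<le> e" "e \<noteq> 24 + p"
    using right_cycle_end[OF assms(1), of "e - 24"] that assms(2) by auto
  have L: "e \<in> set (left_cycle (if w j then swap01 p else p))"
    if "e < 3" "(if w j then swap01 e else e) \<noteq> p"
    using left_cycle_end[of "if w j then swap01 p else p" e] that assms(1) by auto
  have "emb w j e \<in> join_cycle w n i p \<longleftrightarrow>
      (\<exists>k. i = Suc k \<and> emb w j e \<in> emb w k ` set (right_cycle p)) \<or>
      i < n \<and> emb w j e \<in> emb w i ` set (left_cycle (if w i then swap01 p else p))"
    unfolding join_cycle_def by (cases i) auto
  also have "\<dots> \<longleftrightarrow> i = Suc j \<and> e \<in> set (right_cycle p) \<or>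
      i = j \<and> e \<in> set (left_cycle (if w i then swap01 p else p))"
    unfolding mem_right_image_iff[OF assms(1,2)] mem_left_image_iff[OF assms(1,2)]
    using R L assms(3) by blast
  finally show ?thesis .
qed

lemma emb_image_subset:
  assumes "i < n" "A \<subseteq> {..<27}"
  shows "emb w i ` A \<subseteq> {..<24 * n + 3}"
proof -
  have "emb w i e < 24 * n + 3" if "e < 27" for e
    using emb_bounds(2)[OF that, where w = w and j = i] assms(1) by simp
  then show ?thesis using assms(2) by auto
qed

lemma is_cycle_inner:
  assumes "i < n" "I \<in> set inner_cycles"
  shows "is_cycle (chain w n) (emb w i ` set I)"
proof (rule is_cycle_chainI)
  have I: "set I \<subseteq> {3..<24}" by (rule inner_cycles_subset) fact
  then show "emb w i ` set I \<subseteq> {..<24 * n + 3}"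
    using assms(1) by (intro emb_image_subset) auto
  fix j a :: nat assume "a < 18"
  have "e < 27 \<and> emb w j e \<in> emb w i ` set I \<longleftrightarrow> j = i \<and> e \<in> set I" for e
    using mem_inner_image_iff[OF I, of e w j i] I by fastforce
  then have "{e. e < 27 \<and> emb w j e \<in> emb w i ` set I} = (if j = i then set I else {})"
    by simp
  then show "even (card ({e. e < 27 \<and> emb w j e \<in> emb w i ` set I} \<inter> star a))"
    using inner_cycles_even[OF assms(2) \<open>a < 18\<close>] by simp
qed (use assms in auto)

lemma is_cycle_join:
  assumes "i \<le> n" "p < 3" "0 < n"
  shows "is_cycle (chain w n) (join_cycle w n i p)"
proof (rule is_cycle_chainI)
  obtain q where q: "(if w i then swap01 p else p) = q" "q < 3" using assms(2) by auto
  have R: "set (right_cycle p) \<subseteq> {..<27}"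
    using right_cycle_subset[OF assms(2)] by auto
  have L: "set (left_cycle q) \<subseteq> {..<27}"
    using left_cycle_subset[OF q(2)] by auto
  have "emb w (i - 1) ` set (right_cycle p) \<subseteq> {..<24 * n + 3}" if "0 < i"
    using that assms(1) by (intro emb_image_subset R) auto
  then show "join_cycle w n i p \<subseteq> {..<24 * n + 3}"
    using emb_image_subset[OF _ L, of i n w] by (simp add: join_cycle_def q)
  fix j a :: nat assume j: "j < n" "a < 18"
  have "e < 27 \<and> emb w j e \<in> join_cycle w n i p \<longleftrightarrow>
      i = Suc j \<and> e \<in> set (right_cycle p) \<or> i = j \<and> e \<in> set (left_cycle q)" for e
    using mem_join_cycle_iff[OF assms(2) _ j(1), of e w i, unfolded q(1)] R L by blast
  then have "{e. e < 27 \<and> emb w j e \<in> join_cycle w n i p} =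
      (if i = Suc j then set (right_cycle p) else if i = j then set (left_cycle q) else {})"
    by simp
  then show "even (card ({e. e < 27 \<and> emb w j e \<in> join_cycle w n i p} \<inter> star a))"
    using side_cycles_even(1)[OF assms(2) j(2)] side_cycles_even(2)[OF q(2) j(2)] by simp
qed fact

text \<open>An edge of the chain is either interior to a piece or belongs to a join; the \<open>n + 1\<close> joins
  include the two free ends.\<close>

definition interior_edge :: "nat \<Rightarrow> nat \<Rightarrow> bool" where
  "interior_edge j g \<longleftrightarrow> 24 * j + 3 \<le> g \<and> g < 24 * j + 24"

definition join_edge :: "nat \<Rightarrow> nat \<Rightarrow> bool" where
  "join_edge i g \<longleftrightarrow> 24 * i \<le> g \<and> g < 24 * i + 3"

lemma edge_index_unique:
  "interior_edge j g \<Longrightarrow> interior_edge j' g \<Longrightarrow> j = j'"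
  "join_edge j g \<Longrightarrow> join_edge j' g \<Longrightarrow> j = j'"
  "interior_edge j g \<Longrightarrow> \<not> join_edge j' g"
proof -
  show "interior_edge j g \<Longrightarrow> interior_edge j' g \<Longrightarrow> j = j'" "join_edge j g \<Longrightarrow> join_edge j' g \<Longrightarrow> j = j'"
    unfolding interior_edge_def join_edge_def by linarith+
  show "\<not> join_edge j' g" if "interior_edge j g"
  proof
    assume "join_edge j' g"
    with that have "j' < Suc j" "j < j'"
      unfolding interior_edge_def join_edge_def by linarith+
    then show False by simp
  qed
qed

lemma emb_kind:
  assumes "e < 27"
  shows "interior_edge j (emb w j e) \<longleftrightarrow> 3 \<le> e \<and> e < 24" "join_edge j (emb w j e) \<longleftrightarrow> e < 3"
    "join_edge (Suc j) (emb w j e) \<longleftrightarrow> 24 \<le> e"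
  using assms emb_bounds[OF assms, where w = w and j = j]
  by (cases "e < 3"; auto simp: interior_edge_def join_edge_def)+

text \<open>The locality of this cycle and of the next one is what confines an orthogonal triple of
  edges to one piece.\<close>

lemma interior_edge_cycle:
  assumes "interior_edge j g" "j < n"
  obtains C where "is_cycle (chain w n) C" "g \<in> C" "\<And>h. h \<in> C \<Longrightarrow> interior_edge j h"
proof -
  define e where "e = g - 24 * j"
  have e: "3 \<le> e" "e < 24" "g = emb w j e"
    using assms by (auto simp: interior_edge_def e_def emb_def)
  then obtain I where I: "I \<in> set inner_cycles" "e \<in> set I"
    using inner_cycles_cover by blast
  show thesis
  proof (rule that)
    show "is_cycle (chain w n) (emb w j ` set I)"
      using assms(2) I(1) by (rule is_cycle_inner)
    show "g \<in> emb w j ` set I" using e I by blast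
    show "interior_edge j h" if "h \<in> emb w j ` set I" for h
      using that inner_cycles_subset[OF I(1)] by (auto simp: emb_kind)
  qed
qed

lemma join_edge_emb:
  assumes "join_edge i g"
  obtains e where "e < 3" "g = emb w i e"
  using assms emb_image_left[of w i] unfolding join_edge_def
  by (metis atLeastLessThan_iff imageE lessThan_iff)

lemma join_edge_emb':
  assumes "join_edge (Suc i) g"
  obtains e where "24 \<le> e" "e < 27" "g = emb w i e"
  using assms that[of "g - 24 * i"] by (auto simp: join_edge_def emb_def)

lemma join_edge_cycle:
  assumes "join_edge i g" "i \<le> n" "0 < n"
  obtains C where "is_cycle (chain w n) C" "g \<in> C"
    "\<And>h. h \<in> C \<Longrightarrow> join_edge i h \<or> interior_edge i h \<or> (\<exists>k. i = Suc k \<and> interior_edge k h)"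
proof -
  obtain p where p: "p < 3" "g \<in> join_cycle w n i p"
  proof (cases "i < n")
    case True
    obtain e where e: "e < 3" "g = emb w i e"
      using assms(1) join_edge_emb by blast
    \<comment> \<open>The omitted end edge must differ from \<open>e\<close>. Since
      \<open>join_cycle\<close> twists its argument, \<open>q\<close> is passed so that piece
      \<open>i\<close> omits \<open>p\<close>.\<close>
    define p where "p = (if e = 0 then 1 else 0 :: nat)"
    define q where "q = (if w i then swap01 p else p)"
    have "q < 3" "(if w i then swap01 q else q) = p" "p < 3" "e \<noteq> p"
      by (auto simp: q_def p_def)
    moreover from this have "g \<in> join_cycle w n i q"
      unfolding e(2) using e(1) True
      by (subst mem_join_cycle_iff) (auto simp: left_cycle_end)
    ultimately show thesis using that by blast
  next
    case False
    \<comment> \<open>The right free end is seen only from the last piece, through its edges 24 to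
      26.\<close>
    then obtain k where k: "n = Suc k" "i = Suc k"
      using assms(2,3) by (cases n) auto
    obtain e where e: "24 \<le> e" "e < 27" "g = emb w k e"
      using assms(1) join_edge_emb' unfolding k(2) by blast
    define p where "p = (if e = 24 then 1 else 0 :: nat)"
    have "e = 24 + (e - 24)" "e - 24 < 3" "e - 24 \<noteq> p" "p < 3"
      using e by (auto simp: p_def)
    moreover from this have "e \<in> set (right_cycle p)"
      using right_cycle_end by metis
    ultimately show thesis
      using that[of p] e k by (auto simp: mem_join_cycle_iff)
  qed
  show thesis
  proof (rule that[OF is_cycle_join[OF assms(2) p(1) assms(3)] p(2)])
    let ?L = "set (left_cycle (if w i then swap01 p else p))"
    fix h assume "h \<in> join_cycle w n i p"
    then consider k e where "i = Suc k" "h = emb w k e" "e \<in> set (right_cycle p)"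
      | e where "h = emb w i e" "e \<in> ?L"
      unfolding join_cycle_def by (cases i) (auto split: if_splits)
    then show "join_edge i h \<or> interior_edge i h \<or> (\<exists>k. i = Suc k \<and> interior_edge k h)"
    proof cases
      case 1
      then have "3 \<le> e" "e < 27"
        using right_cycle_subset[OF p(1)] by auto
      then show ?thesis
        using emb_kind[of e k w] 1 by auto
    next
      case 2
      moreover have "(if w i then swap01 p else p) < 3" using p(1) by auto
      ultimately have "e < 24"
        using left_cycle_subset by blast
      then show ?thesis
        using emb_kind[of e i w] 2 by auto
    qed
  qed
qed

lemma edge_kind_cases:
  assumes "g < 24 * n + 3"
  obtains j where "j < n" "interior_edge j g" | i where "i \<le> n" "join_edge i g"
proof -
  have g: "g = 24 * (g div 24) + g mod 24" "g mod 24 < 24" by simp_all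
  show thesis
  proof (cases "g mod 24 < 3")
    case True
    then have "g div 24 \<le> n" "join_edge (g div 24) g"
      using assms g unfolding join_edge_def by linarith+
    then show thesis by (rule that(2))
  next
    case False
    then have "g div 24 < n" "interior_edge (g div 24) g"
      using assms g unfolding interior_edge_def by linarith+
    then show thesis by (rule that(1))
  qed
qed

lemma bridgeless_chain:
  assumes "0 < n"
  shows "bridgeless (chain w n)"
  unfolding bridgeless_def
proof
  fix g assume "g \<in> edges (chain w n)"
  then have "g < 24 * n + 3" by (simp add: chain_simps)
  then obtain C where "is_cycle (chain w n) C" "g \<in> C"
  proof (cases rule: edge_kind_cases)
    case (1 j)
    from 1(2,1) show thesis by (rule interior_edge_cycle) (rule that)
  next
    case (2 i)
    from 2(2,1) assms show thesis by (rule join_edge_cycle) (rule that)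
  qed
  then show "\<not> bridge (chain w n) g"
    by (rule even_degree_not_bridge[OF fin_multigraph_chain[OF assms]])
qed

definition in_piece :: "nat \<Rightarrow> nat \<Rightarrow> bool" where
  "in_piece k g \<longleftrightarrow> interior_edge k g \<or> join_edge k g \<or> join_edge (Suc k) g"

lemma in_piece_emb:
  assumes "in_piece k g"
  obtains e where "e < 27" "g = emb w k e"
  using assms unfolding in_piece_def
proof (elim disjE)
  assume "interior_edge k g"
  then have "\<not> g - 24 * k < 3" "24 * k \<le> g" "g - 24 * k < 27"
    unfolding interior_edge_def by linarith+
  then show thesis
    using that[of "g - 24 * k"] by (simp add: emb_def)
next
  assume "join_edge k g"
  then obtain e where "e < 3" "g = emb w k e" by (rule join_edge_emb)
  then show thesis using that[of e] by simp
next
  assume "join_edge (Suc k) g"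
  then obtain e where "24 \<le> e" "e < 27" "g = emb w k e" by (rule join_edge_emb')
  then show thesis using that[of e] by simp
qed

text \<open>Orthogonality to the cycle space: the three edges form a cut.\<close>

locale cut_triple =
  fixes w :: "nat \<Rightarrow> bool" and n g1 g2 g3 :: nat
  assumes pos: "0 < n"
    and edges: "g1 < 24 * n + 3" "g2 < 24 * n + 3" "g3 < 24 * n + 3"
    and orth: "is_cycle (chain w n) C \<Longrightarrow> g3 \<in> C \<longleftrightarrow> (g1 \<in> C) \<noteq> (g2 \<in> C)"
begin

text \<open>A local cycle through \<open>g3\<close> must contain exactly one of the other two edges,
  hence reach the interior of piece \<open>j\<close>.\<close>

lemma two_interior:
  assumes "j < n" "interior_edge j g1" "interior_edge j g2"
  shows "in_piece j g3"
  using edges(3)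
proof (cases rule: edge_kind_cases)
  case (1 k)
  then obtain C where "is_cycle (chain w n) C" "g3 \<in> C" "\<And>h. h \<in> C \<Longrightarrow> interior_edge k h"
    using interior_edge_cycle by metis
  then have "k = j"
    using orth edge_index_unique(1) assms by blast
  then show ?thesis using 1 by (simp add: in_piece_def)
next
  case (2 i)
  then obtain C where "is_cycle (chain w n) C" "g3 \<in> C"
    "\<And>h. h \<in> C \<Longrightarrow> join_edge i h \<or> interior_edge i h \<or> (\<exists>k. i = Suc k \<and> interior_edge k h)"
    using join_edge_cycle pos by metis
  then have "i = j \<or> i = Suc j"
    using orth edge_index_unique(1,3) assms by metis
  then show ?thesis using 2 by (auto simp: in_piece_def)
qed

lemma one_interior:
  assumes "j < n" "interior_edge j g1"
  shows "in_piece j g2 \<and> in_piece j g3"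
proof -
  obtain C where "is_cycle (chain w n) C" "g1 \<in> C" "\<And>h. h \<in> C \<Longrightarrow> interior_edge j h"
    using interior_edge_cycle assms by metis
  then have "interior_edge j g2 \<or> interior_edge j g3"
    using orth by blast
  moreover have "in_piece j g3" if "interior_edge j g2"
    using two_interior assms that by blast
  moreover have "in_piece j g2" if "interior_edge j g3"
  proof -
    \<comment> \<open>The condition says that every cycle contains an even number of the three
      edges, so it is symmetric in them.\<close>
    interpret r: cut_triple w n g3 g1 g2
      using pos edges orth by unfold_locales blast+
    show ?thesis using r.two_interior assms that by blast
  qed
  ultimately show ?thesis by (auto simp: in_piece_def)
qed

text \<open>If the joins differed, a cycle crossing only join \<open>i\<close> and containing
  \<open>g1\<close> would avoid \<open>g2\<close> and so contain \<open>g3\<close>, giving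
  \<open>k = i\<close>; likewise \<open>k = j\<close>.\<close>

lemma no_interior:
  assumes "join_edge i g1" "join_edge j g2" "join_edge k g3" "i \<le> n" "j \<le> n"
  shows "i = j"
proof (rule ccontr)
  assume "i \<noteq> j"
  obtain C where C: "is_cycle (chain w n) C" "g1 \<in> C"
    "\<And>h. h \<in> C \<Longrightarrow> join_edge i h \<or> interior_edge i h \<or> (\<exists>k. i = Suc k \<and> interior_edge k h)"
    using join_edge_cycle assms pos by metis
  obtain D where D: "is_cycle (chain w n) D" "g2 \<in> D"
    "\<And>h. h \<in> D \<Longrightarrow> join_edge j h \<or> interior_edge j h \<or> (\<exists>k. j = Suc k \<and> interior_edge k h)"
    using join_edge_cycle assms pos by metis
  have "g2 \<notin> C"
    using C(3) \<open>i \<noteq> j\<close> assms edge_index_unique(2,3) by metis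
  then have "g3 \<in> C" using orth C(1,2) by blast
  then have "k = i"
    using C(3) assms edge_index_unique(2,3) by metis
  moreover have "g1 \<notin> D"
    using D(3) \<open>i \<noteq> j\<close> assms edge_index_unique(2,3) by metis
  then have "g3 \<in> D" using orth D(1,2) by blast
  then have "k = j"
    using D(3) assms edge_index_unique(2,3) by metis
  ultimately show False using \<open>i \<noteq> j\<close> by simp
qed

lemma common_piece:
  obtains k where "k < n" "in_piece k g1" "in_piece k g2" "in_piece k g3"
proof -
  interpret r2: cut_triple w n g2 g1 g3
    using pos edges orth by unfold_locales blast+
  interpret r3: cut_triple w n g3 g2 g1
    using pos edges orth by unfold_locales blast+
  interpret r4: cut_triple w n g1 g3 g2
    using pos edges orth by unfold_locales blast+
  show thesis
  proof (cases "\<exists>j<n. interior_edge j g1 \<or> interior_edge j g2 \<or> interior_edge j g3")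
    case True
    then obtain j where j: "j < n" "interior_edge j g1 \<or> interior_edge j g2 \<or> interior_edge j g3"
      by blast
    then have "in_piece j g1 \<and> in_piece j g2 \<and> in_piece j g3"
      using one_interior[OF j(1)] r2.one_interior[OF j(1)] r3.one_interior[OF j(1)]
      unfolding in_piece_def by blast
    then show thesis using that j(1) by blast
  next
    case False
    then obtain i1 i2 i3 where i: "join_edge i1 g1" "join_edge i2 g2" "join_edge i3 g3"
      "i1 \<le> n" "i2 \<le> n" "i3 \<le> n"
      using edge_kind_cases edges by metis
    then have "i2 = i1" "i3 = i1"
      using no_interior[OF i(1-3)] r4.no_interior[OF i(1,3,2)] by auto
    then have "in_piece k g1 \<and> in_piece k g2 \<and> in_piece k g3" if "i1 = k \<or> i1 = Suc k" for k
      using that i unfolding in_piece_def by auto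
    \<comment> \<open>Join \<open>i1\<close> is the left end of piece \<open>i1\<close>, except that
      join \<open>n\<close> is the right end of piece \<open>n - 1\<close>.\<close>
    moreover have "\<exists>k<n. i1 = k \<or> i1 = Suc k"
      using i(4) pos by (intro exI[of _ "if i1 = n then n - 1 else i1"]) auto
    ultimately show thesis using that by blast
  qed
qed

lemma star_eq:
  obtains s where "s \<le> 17 * n" "chain_star w s = {g1, g2, g3}"
proof -
  obtain k where k: "k < n" "in_piece k g1" "in_piece k g2" "in_piece k g3"
    by (rule common_piece)
  obtain e1 where e1: "e1 < 27" "g1 = emb w k e1" using k(2) by (rule in_piece_emb)
  obtain e2 where e2: "e2 < 27" "g2 = emb w k e2" using k(3) by (rule in_piece_emb)
  obtain e3 where e3: "e3 < 27" "g3 = emb w k e3" using k(4) by (rule in_piece_emb)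
  obtain a where a: "a < 18" "star a = {e1, e2, e3}"
  proof (rule star_of_triple[OF e1(1) e2(1) e3(1)])
    fix I assume I: "I \<in> set inner_cycles"
    show "(e3 \<in> set I) = ((e1 \<in> set I) \<noteq> (e2 \<in> set I))"
      using orth[OF is_cycle_inner[OF k(1) I]] inner_cycles_subset[OF I] e1 e2 e3
      by (simp add: mem_inner_image_iff)
  next
    fix p :: nat assume p: "p < 3"
    show "(e3 \<in> set (right_cycle p)) = ((e1 \<in> set (right_cycle p)) \<noteq> (e2 \<in> set (right_cycle p)))"
      using orth[OF is_cycle_join[of "Suc k" n p]] k(1) p e1 e2 e3
      by (simp add: mem_join_cycle_iff)
    \<comment> \<open>Again the twist inside \<open>join_cycle\<close> is cancelled, so that the
      test cycle restricts to \<open>left_cycle p\<close> in piece \<open>k\<close>.\<close>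
    define q where "q = (if w k then swap01 p else p)"
    have "q < 3" "(if w k then swap01 q else q) = p"
      using p by (auto simp: q_def)
    then show "(e3 \<in> set (left_cycle p)) = ((e1 \<in> set (left_cycle p)) \<noteq> (e2 \<in> set (left_cycle p)))"
      using orth[OF is_cycle_join[of k n q]] k(1) e1 e2 e3
      by (simp add: mem_join_cycle_iff del: if_split)
  qed
  then have "chain_star w (17 * k + a) = {g1, g2, g3}"
    using e1 e2 e3 by (simp add: chain_star_eq)
  then show thesis
    using that[of "17 * k + a"] a(1) k(1) by simp
qed

end

text \<open>Preimages of cycles are cycles and meet a star, real or virtual, evenly. So the images
  of its three edges form a \<open>cut_triple\<close>, hence a star; injectivity follows by
  counting.\<close>

lemma cycle_continuous_star:
  assumes f: "cycle_continuous (chain w n) (chain w' m) f" and "0 < m" "s \<le> 17 * n"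
  obtains t where "t \<le> 17 * m" "f ` chain_star w s = chain_star w' t" "inj_on f (chain_star w s)"
proof -
  obtain g1 g2 g3 where g: "chain_star w s = {g1, g2, g3}" "g1 \<noteq> g2" "g1 \<noteq> g3" "g2 \<noteq> g3"
    using card_chain_star[of w s] by (auto simp: card_3_iff)
  have sub: "chain_star w s \<subseteq> edges (chain w n)"
    using chain_star_subset[OF assms(3)] by (simp add: chain_simps)
  have into: "f ` edges (chain w n) \<subseteq> edges (chain w' m)"
    using f by (auto simp: cycle_continuous_def)
  interpret cut_triple w' m "f g1" "f g2" "f g3"
  proof
    show "f g1 < 24 * m + 3" "f g2 < 24 * m + 3" "f g3 < 24 * m + 3"
      using sub into g(1) by (auto simp: chain_simps)
    fix C assume "is_cycle (chain w' m) C"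
    then have "is_cycle (chain w n) (f -` C \<inter> edges (chain w n))"
      using f by (simp add: cycle_continuous_def)
    then have "even (card ((f -` C \<inter> edges (chain w n)) \<inter> chain_star w s))"
      using assms(3) by (rule is_cycle_chain_even)
    moreover have "(f -` C \<inter> edges (chain w n)) \<inter> chain_star w s =
        (if f g1 \<in> C then {g1} else {}) \<union> (if f g2 \<in> C then {g2} else {}) \<union> (if f g3 \<in> C then {g3} else {})"
      using sub g(1) by auto
    ultimately show "f g3 \<in> C \<longleftrightarrow> (f g1 \<in> C) \<noteq> (f g2 \<in> C)"
      using g(2-4) by (auto split: if_splits)
  qed fact
  obtain t where t: "t \<le> 17 * m" "chain_star w' t = {f g1, f g2, f g3}"
    by (rule star_eq)
  then have "f ` chain_star w s = chain_star w' t"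
    using g(1) by simp
  moreover from this have "inj_on f (chain_star w s)"
    by (intro eq_card_imp_inj_on) (simp_all add: card_chain_star)
  ultimately show thesis using that t(1) by blast
qed

subsection \<open>Maps from the snark into a chain\<close>

text \<open>The chain is coloured piece by piece. \<open>H\<close> holds the stars that must be
  proper, at most nine of them inside any piece. Keeping each join proper as well lets the next
  near-colouring be matched to the previous ones by renaming colours.\<close>

lemma ex_colouring:
  assumes "finite H" "card H \<le> 9"
  shows "\<exists>c :: nat \<Rightarrow> nat. (\<forall>g. c g < 3) \<and>
    (\<forall>s\<in>H. s \<le> 17 * k \<longrightarrow> inj_on c (chain_star w s)) \<and> inj_on c (chain_star w (17 * k))"
proof (induction k)
  case 0
  have "chain_star w 0 = {..<3}"
    using emb_image_left[of w 0] by (simp add: chain_star_def star_0 lessThan_atLeast0)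
  then have "inj_on (\<lambda>g. g mod 3) (chain_star w 0)"
    by (auto simp: inj_on_def)
  then show ?case
    by (intro exI[of _ "\<lambda>g. g mod 3"]) auto
next
  case (Suc k)
  then obtain c :: "nat \<Rightarrow> nat" where c: "\<forall>g. c g < 3"
    "\<forall>s\<in>H. s \<le> 17 * k \<longrightarrow> inj_on c (chain_star w s)" "inj_on c (chain_star w (17 * k))"
    by blast
  define W where "W = {b \<in> {1..16}. 17 * k + b \<in> H}"
  have "card W = card ((\<lambda>b. 17 * k + b) ` W)"
    by (simp add: card_image)
  also have "\<dots> \<le> card H"
    using assms(1) by (intro card_mono) (auto simp: W_def)
  finally have "card W \<le> 9"
    using assms(2) by simp
  moreover have "W \<subseteq> {1..16}" by (auto simp: W_def)
  ultimately obtain d :: "nat \<Rightarrow> nat" where d: "\<forall>e<27. d e < 3" "\<forall>a\<in>W \<union> {0, 17}. inj_on d (star a)"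
    using near_colouring by blast
  \<comment> \<open>The renaming of colours that makes \<open>d\<close> agree with \<open>c\<close>
    on the join at the left of piece \<open>k\<close>.\<close>
  define \<pi> where "\<pi> t = c (emb w k (inv_into {..<3} d t))" for t
  have inj_d: "inj_on d {..<3}"
    using d(2) by (auto simp: star_0)
  have "d ` {..<3} = {..<3}"
    using d(1) inj_d by (intro card_subset_eq) (auto simp: card_image)
  have inj_c: "inj_on c (emb w k ` {..<3})"
    using c(3) chain_star_eq[of 0 w k] by (simp add: star_0)
  have "inj_on (emb w k) {..<3}"
    by (rule inj_on_subset[OF inj_on_emb]) auto
  then have inj_ce: "inj_on (\<lambda>e. c (emb w k e)) {..<3}"
    using inj_c comp_inj_on[of "emb w k" "{..<3}" c] by (simp add: comp_def)
  have \<pi>_d: "\<pi> (d e) = c (emb w k e)" if "e < 3" for e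
    using that inj_d by (simp add: \<pi>_def)
  have inj_\<pi>: "inj_on \<pi> {..<3}"
  proof -
    have "inj_on \<pi> (d ` {..<3})"
    proof (rule inj_on_imageI)
      have "inj_on (\<pi> \<circ> d) {..<3} = inj_on (\<lambda>e. c (emb w k e)) {..<3}"
        by (rule inj_on_cong) (simp add: \<pi>_d)
      then show "inj_on (\<pi> \<circ> d) {..<3}" using inj_ce by simp
    qed
    then show ?thesis using \<open>d ` {..<3} = {..<3}\<close> by simp
  qed
  \<comment> \<open>The value 0 beyond piece \<open>k\<close> keeps every colour below 3; those
    edges are recoloured at later stages.\<close>
  define c' where "c' g = (if g < 24 * k + 3 then c g else if g < 24 * k + 27 then \<pi> (d (g - 24 * k)) else 0)" for g
  have c'_emb: "c' (emb w k e) = \<pi> (d e)" if "e < 27" for e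
    using that emb_bounds[OF that, where w = w and j = k] \<pi>_d[of e] by (cases "e < 3") (auto simp: c'_def)
  have c'_old: "inj_on c' (chain_star w s)" if "s \<le> 17 * k" "inj_on c (chain_star w s)" for s
  proof -
    have "inj_on c' (chain_star w s) = inj_on c (chain_star w s)"
      using chain_star_subset[OF that(1), of w] by (intro inj_on_cong) (auto simp: c'_def)
    then show ?thesis using that(2) by simp
  qed
  have c'_new: "inj_on c' (chain_star w (17 * k + a))" if "a \<in> W \<union> {0, 17}" for a
  proof -
    have a: "a < 18" using that by (auto simp: W_def)
    have "inj_on (\<pi> \<circ> d) (star a)"
    proof (rule comp_inj_on)
      show "inj_on d (star a)" using d(2) that by blast
      show "inj_on \<pi> (d ` star a)"
        using d(1) by (intro inj_on_subset[OF inj_\<pi>]) (auto simp: in_star_iff)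
    qed
    moreover have "inj_on (c' \<circ> emb w k) (star a) = inj_on (\<pi> \<circ> d) (star a)"
      by (rule inj_on_cong) (auto simp: c'_emb in_star_iff)
    ultimately have "inj_on c' (emb w k ` star a)"
      by (intro inj_on_imageI) simp
    then show ?thesis using a by (simp add: chain_star_eq)
  qed
  show ?case
  proof (intro exI[of _ c'] conjI allI ballI impI)
    have "\<pi> t < 3" for t using c(1) by (simp add: \<pi>_def)
    then show "c' g < 3" for g using c(1) by (simp add: c'_def)
    show "inj_on c' (chain_star w (17 * Suc k))"
      using c'_new[of 17] by (simp add: add.commute)
    fix s assume s: "s \<in> H" "s \<le> 17 * Suc k"
    show "inj_on c' (chain_star w s)"
    proof (cases "s \<le> 17 * k")
      case True
      then show ?thesis using c(2) s c'_old by blast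
    next
      case False
      then obtain b where b: "s = 17 * k + b" "1 \<le> b" "b \<le> 17"
        using s(2) that[of "s - 17 * k"] by auto
      then have "b \<in> W \<union> {0, 17}"
        using s(1) by (auto simp: W_def)
      then show ?thesis using c'_new b(1) by blast
    qed
  qed
qed

section \<open>Parities of the fibres on stars\<close>

lemma card_fibres:
  assumes "finite A" "finite S"
  shows "card {a \<in> A. \<phi> a \<in> S} = (\<Sum>s\<in>S. card {a \<in> A. \<phi> a = s})"
proof -
  have "{a \<in> A. \<phi> a \<in> S} = (\<Union>s\<in>S. {a \<in> A. \<phi> a = s})" by auto
  then show ?thesis
    using assms by (simp add: card_UN_disjoint disjoint_iff)
qed

text \<open>The restriction of a cycle-continuous map to one piece of the source: \<open>F\<close>
  acts on its edges and \<phi> on its stars.\<close>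

locale snark_map =
  fixes w :: "nat \<Rightarrow> bool" and n :: nat and F \<phi> :: "nat \<Rightarrow> nat"
  assumes \<phi>_le: "a < 18 \<Longrightarrow> \<phi> a \<le> 17 * n"
    and F_star: "a < 18 \<Longrightarrow> F ` star a = chain_star w (\<phi> a)"
begin

definition fibre :: "nat \<Rightarrow> nat" where
  "fibre s = card {a \<in> {..<18}. \<phi> a = s}"

lemma F_inj: "a < 18 \<Longrightarrow> inj_on F (star a)"
  using F_star[of a] by (intro eq_card_imp_inj_on) (simp_all add: card_chain_star card_star)

lemma fibre_pos: "0 < fibre s \<longleftrightarrow> s \<in> \<phi> ` {..<18}"
  unfolding fibre_def by (subst card_gt_0_iff) auto

text \<open>The edges sent to \<open>g\<close> meet the star of \<open>a\<close> once if \<phi>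
  sends \<open>a\<close> to a star containing \<open>g\<close>, and not at all otherwise. Double
  counting then makes the number of such \<open>a\<close> even. \<open>S\<close> includes virtual
  stars.\<close>

lemma even_fibre_sum:
  assumes "finite S" "\<And>s. g \<in> chain_star w s \<longleftrightarrow> s \<in> S"
  shows "even (\<Sum>s\<in>S. fibre s)"
proof -
  let ?D = "{e. e < 27 \<and> F e = g}"
  have "card (?D \<inter> star a) = of_bool (\<phi> a \<in> S)" if a: "a < 18" for a
  proof (cases "\<phi> a \<in> S")
    case True
    then have "g \<in> F ` star a"
      using assms(2)[of "\<phi> a"] F_star[OF a] by simp
    then obtain e where e: "e \<in> star a" "F e = g" by blast
    have "x = e" if "x \<in> ?D \<inter> star a" for x
      using inj_onD[OF F_inj[OF a], of x e] that e by simp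
    moreover have "e \<in> ?D \<inter> star a"
      using e by (simp add: in_star_iff)
    ultimately have "?D \<inter> star a = {e}" by blast
    then show ?thesis using True by simp
  next
    case False
    then have "?D \<inter> star a = {}"
      using assms(2)[of "\<phi> a"] F_star[OF a] by auto
    then show ?thesis using False by simp
  qed
  then have "(\<Sum>a<18. card (?D \<inter> star a)) = (\<Sum>a<(18::nat). of_bool (\<phi> a \<in> S))"
    by (intro sum.cong) auto
  also have "\<dots> = card {a \<in> {..<18}. \<phi> a \<in> S}"
    by (simp add: Int_def flip: Collect_conj_eq)
  also have "\<dots> = (\<Sum>s\<in>S. fibre s)"
    unfolding fibre_def using assms(1) by (intro card_fibres) auto
  finally show ?thesis
    using handshake[of ?D] by (metis (no_types, lifting) dvd_triv_left lessThan_iff mem_Collect_eq subsetI)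
qed

text \<open>An interior edge of a target piece lies in just two stars, whose fibres thus have equal
  parity. Induction follows the tree of \<open>inner_tree\<close> down to vertex 1.\<close>

lemma fibre_interior:
  assumes "1 \<le> b" "b \<le> 16"
  shows "even (fibre (17 * j + b)) \<longleftrightarrow> even (fibre (17 * j + 1))"
  using assms
proof (induction b rule: less_induct)
  case (less b)
  show ?case
  proof (cases "b = 1")
    case False
    then obtain e where e: "3 \<le> e" "e < 24" "hi e = b"
      using inner_tree[of b] less.prems by auto
    have lo: "1 \<le> lo e" "lo e < b"
      using snark_ends[of e] e by auto
    have "even (\<Sum>s\<in>{17 * j + lo e, 17 * j + hi e}. fibre s)"
      using e by (intro even_fibre_sum[of _ "emb w j e"]) (auto simp: mem_chain_star_iff)
    then have "even (fibre (17 * j + lo e)) \<longleftrightarrow> even (fibre (17 * j + b))"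
      using lo e by simp
    then show ?thesis
      using less.IH[of "lo e"] lo less.prems by simp
  qed simp
qed

text \<open>Edge 0 of piece \<open>j\<close> lies in the star \<open>17 * j\<close>, in one star
  inside piece \<open>j\<close> and, for positive \<open>j\<close>, in one inside piece
  \<open>j - 1\<close>. Stars beyond the chain have empty fibres, so the right free end is covered
  as well.\<close>

lemma fibre_join:
  "even (fibre (17 * j)) \<longleftrightarrow>
    (even (fibre (17 * j + 1)) \<longleftrightarrow> (\<forall>i. j = Suc i \<longrightarrow> even (fibre (17 * i + 1))))"
proof -
  let ?t = "24 + (if w j then swap01 0 else 0)"
  have t: "24 \<le> ?t" "?t < 27" by (auto simp: swap01_def)
  have hi: "1 \<le> hi 0" "hi 0 \<le> 16" and lo: "lo 0 = 0" by simp_all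
  have lo_t: "1 \<le> lo ?t" "lo ?t \<le> 16"
    using snark_ends(1,4,6)[of ?t] t by auto
  show ?thesis
  proof (cases j)
    case 0
    have "even (\<Sum>s\<in>{17 * j, 17 * j + hi 0}. fibre s)"
      using 0 lo by (intro even_fibre_sum[of _ "emb w j 0"]) (auto simp: mem_chain_star_iff simp del: lo_simps hi_simps)
    then show ?thesis
      using fibre_interior[OF hi, of j] hi 0 by (simp del: lo_simps hi_simps)
  next
    case (Suc i)
    have "even (\<Sum>s\<in>{17 * j, 17 * j + hi 0, 17 * i + lo ?t}. fibre s)"
      using Suc lo by (intro even_fibre_sum[of _ "emb w j 0"]) (auto simp: mem_chain_star_iff simp del: lo_simps hi_simps)
    moreover have "17 * i + lo ?t < 17 * j" "17 * j < 17 * j + hi 0"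
      using Suc lo_t hi by linarith+
    ultimately have "even (fibre (17 * j) + fibre (17 * j + hi 0) + fibre (17 * i + lo ?t))"
      by (simp add: add.assoc del: lo_simps hi_simps)
    then show ?thesis
      using fibre_interior[OF hi, of j] fibre_interior[OF lo_t, of i] Suc
      by (simp del: lo_simps hi_simps) blast
  qed
qed

text \<open>All 16 interior stars of piece \<open>i\<close> are hit. A second odd piece would
  require 32 hit stars out of at most 18, so the neighbouring pieces are even and both end stars of
  piece \<open>i\<close> are odd. Now 18 stars are hit by 18 vertices.\<close>

lemma piece_image:
  assumes "odd (fibre (17 * i + 1))"
  shows "i < n" "inj_on \<phi> {..<18}" "\<phi> ` {..<18} = {17 * i..<17 * i + 18}"
proof -
  have interior: "{17 * k + 1..<17 * k + 17} \<subseteq> \<phi> ` {..<18}" if "odd (fibre (17 * k + 1))" for k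
  proof
    fix s assume "s \<in> {17 * k + 1..<17 * k + 17}"
    then have "s = 17 * k + (s - 17 * k)" "1 \<le> s - 17 * k" "s - 17 * k \<le> 16"
      by auto
    then have "odd (fibre s)" using that fibre_interior[of "s - 17 * k" k] by simp
    then have "0 < fibre s" by (rule odd_pos)
    then show "s \<in> \<phi> ` {..<18}" by (simp add: fibre_pos)
  qed
  have "17 * i + 1 \<le> 17 * n"
    using interior[OF assms] \<phi>_le by force
  then show "i < n" by simp
  have unique: "even (fibre (17 * k + 1))" if "k \<noteq> i" for k
  proof (rule ccontr)
    assume odd: "odd (fibre (17 * k + 1))"
    have "{17 * i + 1..<17 * i + 17} \<inter> {17 * k + 1..<17 * k + 17} = {}"
      using that by (cases i k rule: linorder_cases) auto
    then have "card ({17 * i + 1..<17 * i + 17} \<union> {17 * k + 1..<17 * k + 17}) = 32"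
      by (subst card_Un_disjoint) auto
    moreover have "card ({17 * i + 1..<17 * i + 17} \<union> {17 * k + 1..<17 * k + 17}) \<le> card (\<phi> ` {..<18})"
      using interior[OF assms] interior[OF odd] by (intro card_mono) auto
    moreover have "card (\<phi> ` {..<18}) \<le> 18"
      using card_image_le[of "{..<18}" \<phi>] by simp
    ultimately show False by simp
  qed
  have "odd (fibre (17 * i))"
    using fibre_join[of i] assms unique by auto
  then have "17 * i \<in> \<phi> ` {..<18}"
    using fibre_pos odd_pos by blast
  moreover have "odd (fibre (17 * Suc i))"
    using fibre_join[of "Suc i"] assms unique[of "Suc i"] by simp
  then have "17 * i + 17 \<in> \<phi> ` {..<18}"
    using fibre_pos[of "17 * Suc i"] odd_pos by (simp add: add.commute)
  moreover have "{17 * i..<17 * i + 18} = {17 * i + 1..<17 * i + 17} \<union> {17 * i, 17 * i + 17}"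
    by auto
  ultimately have sub: "{17 * i..<17 * i + 18} \<subseteq> \<phi> ` {..<18}"
    using interior[OF assms] by simp
  have "card (\<phi> ` {..<18}) \<le> 18"
    using card_image_le[of "{..<18}" \<phi>] by simp
  then have "\<phi> ` {..<18} = {17 * i..<17 * i + 18}"
    using card_seteq[OF _ sub] by simp
  then show "\<phi> ` {..<18} = {17 * i..<17 * i + 18}" "inj_on \<phi> {..<18}"
    by (auto intro: eq_card_imp_inj_on)
qed

text \<open>Otherwise all fibres are even, every hit star is hit at least twice, and
  \<open>ex_colouring\<close> applies to the at most nine hit stars. Its colouring pulls back along
  \<open>F\<close>.\<close>

lemma ex_odd_fibre: "\<exists>i. odd (fibre (17 * i + 1))"
proof (rule ccontr)
  assume "\<not> ?thesis"
  then have ev1: "even (fibre (17 * i + 1))" for i by blast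
  have ev: "even (fibre s)" for s
  proof -
    have "s = 17 * (s div 17) + s mod 17" "s mod 17 < 17" by simp_all
    then show ?thesis
      using ev1 fibre_join[of "s div 17"] fibre_interior[of "s mod 17" "s div 17"]
      by (cases "s mod 17 = 0") auto
  qed
  let ?H = "\<phi> ` {..<18}"
  have "2 * card ?H = (\<Sum>s\<in>?H. 2)" by simp
  also have "\<dots> \<le> (\<Sum>s\<in>?H. fibre s)"
  proof (rule sum_mono)
    fix s assume "s \<in> ?H"
    then have "0 < fibre s" by (simp add: fibre_pos)
    moreover obtain r where "fibre s = 2 * r" using ev by (rule evenE)
    ultimately show "2 \<le> fibre s" by simp
  qed
  also have "\<dots> = card {a \<in> {..<18}. \<phi> a \<in> ?H}"
    unfolding fibre_def by (rule card_fibres[symmetric]) auto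
  also have "\<dots> \<le> 18"
    by (rule order_trans[OF card_mono[of "{..<18}"]]) auto
  finally have "card ?H \<le> 9" by simp
  then obtain c :: "nat \<Rightarrow> nat" where c: "\<forall>g. c g < 3"
    "\<forall>s\<in>?H. s \<le> 17 * n \<longrightarrow> inj_on c (chain_star w s)"
    using ex_colouring[of ?H n w] by blast
  show False
  proof (rule not_colourable[of "c \<circ> F"])
    show "\<forall>e<27. (c \<circ> F) e < 3" using c(1) by simp
    show "\<forall>a<18. inj_on (c \<circ> F) (star a)"
    proof (intro allI impI comp_inj_on)
      fix a :: nat assume a: "a < 18"
      show "inj_on F (star a)" using a by (rule F_inj)
      show "inj_on c (F ` star a)"
        using c(2) a \<phi>_le[OF a] by (simp add: F_star)
    qed
  qed
qed

lemma automorphism_of_piece: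
  obtains i \<psi> \<gamma> where "i < n" "bij_betw \<psi> {..<18} {..<18}"
    "\<And>a. a < 18 \<Longrightarrow> \<gamma> ` star a = star (\<psi> a)" "\<And>a. a < 18 \<Longrightarrow> \<phi> a = 17 * i + \<psi> a"
    "\<And>e. e < 27 \<Longrightarrow> \<gamma> e < 27 \<and> F e = emb w i (\<gamma> e)"
proof -
  obtain i where "odd (fibre (17 * i + 1))"
    using ex_odd_fibre by blast
  note i = piece_image[OF this]
  define \<psi> where "\<psi> a = \<phi> a - 17 * i" for a
  have \<phi>: "\<phi> a = 17 * i + \<psi> a" "\<psi> a < 18" if "a < 18" for a
  proof -
    have "\<phi> a \<in> {17 * i..<17 * i + 18}" using i(3) that by blast
    then show "\<phi> a = 17 * i + \<psi> a" "\<psi> a < 18" by (auto simp: \<psi>_def)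
  qed
  have "inj_on \<psi> {..<18}"
    using i(2) \<phi>(1) by (auto simp: inj_on_def)
  moreover have "\<psi> ` {..<18} \<subseteq> {..<18}"
    using \<phi>(2) by auto
  ultimately have bij: "bij_betw \<psi> {..<18} {..<18}"
    by (simp add: bij_betw_def endo_inj_surj)
  have "\<exists>e'<27. F e = emb w i e'" if "e < 27" for e
  proof -
    have lo: "lo e < 18" "e \<in> star (lo e)"
      using snark_ends(1,2)[OF that] that by (auto simp: in_star_iff)
    then have "F e \<in> chain_star w (17 * i + \<psi> (lo e))"
      using F_star[of "lo e"] \<phi>(1) by auto
    then show ?thesis
      using \<phi>(2)[OF lo(1)] by (auto simp: chain_star_eq in_star_iff)
  qed
  then obtain \<gamma> where \<gamma>: "\<And>e. e < 27 \<Longrightarrow> \<gamma> e < 27 \<and> F e = emb w i (\<gamma> e)"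
    by metis
  have "\<gamma> ` star a = star (\<psi> a)" if a: "a < 18" for a
  proof -
    have "emb w i ` (\<gamma> ` star a) = F ` star a"
      using \<gamma> by (auto simp: image_image in_star_iff intro!: image_cong)
    also have "\<dots> = emb w i ` star (\<psi> a)"
      using F_star[OF a] \<phi>[OF a] by (simp add: chain_star_eq)
    finally have "emb w i ` (\<gamma> ` star a) = emb w i ` star (\<psi> a)" .
    moreover have "\<gamma> ` star a \<subseteq> {..<27}"
      using \<gamma> by (auto simp: in_star_iff)
    ultimately show ?thesis
      by (simp only: inj_on_image_eq_iff[OF inj_on_emb _ star_subset])
  qed
  then show thesis
    using that i(1) bij \<phi>(1) \<gamma> by blast
qed

end

subsection \<open>Automorphisms of the snark\<close>

text \<open>An automorphism in the form in which it arises: a bijection of the vertices together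
  with an edge map carrying stars to stars.\<close>

locale snark_auto =
  fixes \<psi> \<gamma> :: "nat \<Rightarrow> nat"
  assumes bij: "bij_betw \<psi> {..<18} {..<18}"
    and \<gamma>_star: "a < 18 \<Longrightarrow> \<gamma> ` star a = star (\<psi> a)"
begin

lemma \<psi>_less: "a < 18 \<Longrightarrow> \<psi> a < 18"
  using bij by (auto simp: bij_betw_def)

lemma nbs_less: "nbs a \<subseteq> {..<18}"
  using snark_ends(1,2) by (force simp: nbs_def in_star_iff disjoint_iff)

lemma card_nbs: "a < 18 \<Longrightarrow> card (nbs a) = 3"
proof -
  have "\<forall>a<18. card (nbs a) = 3" by (simp add: all_less_18 nbs_simps)
  then show "a < 18 \<Longrightarrow> card (nbs a) = 3" by blast
qed

lemma nbs_\<psi>: assumes a: "a < 18" shows "nbs (\<psi> a) = \<psi> ` nbs a"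
proof (rule card_subset_eq[symmetric])
  have inj: "inj_on \<psi> {..<18}" using bij by (simp add: bij_betw_def)
  show "finite (nbs (\<psi> a))" using nbs_less finite_subset by blast
  show "\<psi> ` nbs a \<subseteq> nbs (\<psi> a)"
  proof (rule image_subsetI)
    fix b assume b: "b \<in> nbs a"
    then have "b < 18" "b \<noteq> a" using nbs_less by (auto simp: nbs_def)
    then have "\<psi> b \<noteq> \<psi> a"
      using inj a by (auto simp: inj_on_def)
    moreover have "\<gamma> ` (star a \<inter> star b) \<subseteq> star (\<psi> a) \<inter> star (\<psi> b)"
      using \<gamma>_star[OF a] \<gamma>_star[OF \<open>b < 18\<close>] by blast
    ultimately show "\<psi> b \<in> nbs (\<psi> a)"
      using b by (auto simp: nbs_def)
  qed
  show "card (\<psi> ` nbs a) = card (nbs (\<psi> a))"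
    using card_nbs[OF a] card_nbs[OF \<psi>_less[OF a]] card_image[OF inj_on_subset[OF inj nbs_less], of a]
    by simp
qed

lemma pentagonal_\<psi>: assumes a: "a < 18" shows "pentagonal (\<psi> a) \<longleftrightarrow> pentagonal a"
proof -
  have inj: "inj_on \<psi> {..<18}" using bij by (simp add: bij_betw_def)
  have less: "b < 18" if "b \<in> nbs c" for b c using that nbs_less by blast
  have mem: "\<psi> p \<in> nbs (\<psi> q) \<longleftrightarrow> p \<in> nbs q" if "p < 18" "q < 18" for p q
    unfolding nbs_\<psi>[OF that(2)] using inj_on_image_mem_iff[OF inj, of p "nbs q"] that nbs_less by blast
  have "(\<exists>p\<in>nbs (\<psi> b). \<exists>q\<in>nbs (\<psi> c). p \<in> nbs q) \<longleftrightarrow> (\<exists>p\<in>nbs b. \<exists>q\<in>nbs c. p \<in> nbs q)"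
    if "b < 18" "c < 18" for b c
    unfolding nbs_\<psi>[OF that(1)] nbs_\<psi>[OF that(2)] bex_simps(7)
    using mem less by blast
  moreover have "\<psi> b = \<psi> c \<longleftrightarrow> b = c" if "b < 18" "c < 18" for b c
    using inj that by (auto simp: inj_on_def)
  ultimately show ?thesis
    unfolding pentagonal_def nbs_\<psi>[OF a] ball_simps(9) using less by (intro ball_cong refl) auto
qed

lemma incident_images:
  assumes "e < 27" "a < 18" "b < 18" "a \<noteq> b" "e \<in> star a" "e \<in> star b"
  shows "\<gamma> e \<in> star (\<psi> a)" "\<gamma> e \<in> star (\<psi> b)" "\<psi> a \<noteq> \<psi> b"
  using assms \<gamma>_star[of a] \<gamma>_star[of b] bij by (auto simp: bij_betw_def inj_on_def)

text \<open>Edge 0 is the only edge at vertex 0 whose other end is not pentagonal.\<close>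

lemma left_end_fixed:
  assumes "\<psi> 0 = 0" "e < 3"
  shows "\<gamma> e = 0 \<longleftrightarrow> e = 0"
proof -
  have pent: "pentagonal (hi e) \<longleftrightarrow> e \<noteq> 0" if "e < 3" for e
  proof -
    have "e = 0 \<or> e = 1 \<or> e = 2" using that by auto
    then show ?thesis using pentagonal_simps by auto
  qed
  have e: "e < 27" "lo e = 0" "lo e < hi e" "hi e < 18"
    using snark_ends[of e] assms(2) by auto
  have "\<gamma> e \<in> star 0" "\<gamma> e \<in> star (\<psi> (hi e))" "\<psi> (hi e) \<noteq> 0"
    using incident_images[of e 0 "hi e"] e assms(1) by (auto simp: in_star_iff)
  then have "\<gamma> e < 3" "hi (\<gamma> e) = \<psi> (hi e)"
    using snark_ends(3)[of "\<gamma> e"] by (auto simp: star_0 in_star_iff)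
  then show ?thesis
    using pent[of e] pent[of "\<gamma> e"] pentagonal_\<psi>[OF e(4)] assms(2) by metis
qed

text \<open>Edge 24 is the only edge at vertex 17 whose other end is pentagonal.\<close>

lemma right_end_fixed:
  assumes "\<psi> 17 = 17"
  shows "\<gamma> 24 = 24"
proof -
  have pent: "pentagonal (lo e) \<longleftrightarrow> e = 24" if "24 \<le> e" "e < 27" for e
  proof -
    have "e = 24 \<or> e = 25 \<or> e = 26" using that by auto
    then show ?thesis using pentagonal_simps by auto
  qed
  have "\<gamma> 24 \<in> star 17" "\<gamma> 24 \<in> star (\<psi> 3)" "\<psi> 3 \<noteq> 17"
    using incident_images[of 24 17 3] assms by (auto simp: in_star_iff)
  then have "24 \<le> \<gamma> 24" "\<gamma> 24 < 27" "lo (\<gamma> 24) = \<psi> 3"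
    using snark_ends(6)[of "\<gamma> 24"] by (auto simp: star_17 in_star_iff)
  then show ?thesis
    using pent[of "\<gamma> 24"] pentagonal_\<psi>[of 3] pentagonal_simps by simp
qed

end

section \<open>Comparison of chains and the antichain\<close>

text \<open>Each source piece maps isomorphically onto a target piece. The star shared by
  consecutive pieces forces their images to be consecutive in the same order, and the marked edges 0
  and 24 detect the twist.\<close>

lemma cycle_continuous_shift:
  assumes f: "cycle_continuous (chain w n) (chain w' m) f" and "0 < n" "0 < m"
  obtains k where "k + n \<le> m" "\<And>j. 0 < j \<Longrightarrow> j < n \<Longrightarrow> w j \<Longrightarrow> w' (k + j)"
proof -
  have "\<exists>t. s \<le> 17 * n \<longrightarrow> t \<le> 17 * m \<and> f ` chain_star w s = chain_star w' t" for s
    using cycle_continuous_star[OF f \<open>0 < m\<close>] by metis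
  then obtain T where T: "\<And>s. s \<le> 17 * n \<Longrightarrow> T s \<le> 17 * m \<and> f ` chain_star w s = chain_star w' (T s)"
    by metis
  have "\<exists>i \<psi> \<gamma>. i < m \<and> snark_auto \<psi> \<gamma> \<and> (\<forall>a<18. T (17 * j + a) = 17 * i + \<psi> a) \<and>
      (\<forall>e<27. \<gamma> e < 27 \<and> f (emb w j e) = emb w' i (\<gamma> e))" if j: "j < n" for j
  proof -
    interpret snark_map w' m "\<lambda>e. f (emb w j e)" "\<lambda>a. T (17 * j + a)"
    proof
      fix a :: nat assume a: "a < 18"
      have "17 * j + a \<le> 17 * n" using a j by linarith
      then show "T (17 * j + a) \<le> 17 * m" "(\<lambda>e. f (emb w j e)) ` star a = chain_star w' (T (17 * j + a))"
        using T[of "17 * j + a"] a by (auto simp: chain_star_eq image_image)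
    qed
    obtain i \<psi> \<gamma> where "i < m" "bij_betw \<psi> {..<18} {..<18}"
      "\<And>a. a < 18 \<Longrightarrow> \<gamma> ` star a = star (\<psi> a)" "\<And>a. a < 18 \<Longrightarrow> T (17 * j + a) = 17 * i + \<psi> a"
      "\<And>e. e < 27 \<Longrightarrow> \<gamma> e < 27 \<and> f (emb w j e) = emb w' i (\<gamma> e)"
      by (rule automorphism_of_piece) blast
    then show ?thesis
      unfolding snark_auto_def by blast
  qed
  then obtain i \<psi> \<gamma> where piece: "\<And>j. j < n \<Longrightarrow> i j < m \<and> snark_auto (\<psi> j) (\<gamma> j) \<and>
      (\<forall>a<18. T (17 * j + a) = 17 * i j + \<psi> j a) \<and>
      (\<forall>e<27. \<gamma> j e < 27 \<and> f (emb w j e) = emb w' (i j) (\<gamma> j e))"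
    by metis
  have step: "i (Suc j) = Suc (i j) \<and> (w (Suc j) \<longrightarrow> w' (Suc (i j)))" if j: "Suc j < n" for j
  proof -
    interpret p: snark_auto "\<psi> j" "\<gamma> j" using piece[of j] j by simp
    interpret q: snark_auto "\<psi> (Suc j)" "\<gamma> (Suc j)" using piece[of "Suc j"] j by simp
    have "T (17 * j + a) = 17 * i j + \<psi> j a" "T (17 * Suc j + a) = 17 * i (Suc j) + \<psi> (Suc j) a"
      if "a < 18" for a
      using piece[of j] piece[of "Suc j"] j that by simp_all
    from this(1)[of 17] this(2)[of 0]
    have eq: "17 * i j + \<psi> j 17 = 17 * i (Suc j) + \<psi> (Suc j) 0"
      by (simp add: add.commute)
    have pent: "pentagonal (\<psi> j 17)" "\<not> pentagonal (\<psi> (Suc j) 0)"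
      using p.pentagonal_\<psi>[of 17] q.pentagonal_\<psi>[of 0] pentagonal_simps by simp_all
    have less: "\<psi> j 17 < 18" "\<psi> (Suc j) 0 < 18"
      using p.\<psi>_less q.\<psi>_less by simp_all
    have "\<psi> j 17 \<noteq> \<psi> (Suc j) 0" using pent by metis
    moreover have "i (Suc j) \<le> Suc (i j)" "i j \<le> Suc (i (Suc j))"
      using eq less by linarith+
    then have "i (Suc j) = i j \<or> i (Suc j) = Suc (i j) \<or> i j = Suc (i (Suc j))"
      by linarith
    \<comment> \<open>Images in the same piece would identify a pentagonal vertex with one that is
      not. If the order were reversed, vertex 17 would go to 0, which is excluded below for the same
      reason.\<close>
    ultimately consider "\<psi> j 17 = 17" "\<psi> (Suc j) 0 = 0" "i (Suc j) = Suc (i j)" | "\<psi> j 17 = 0"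
      using eq less by auto
    then show ?thesis
    proof cases
      case 1
      have "w' (Suc (i j))" if w: "w (Suc j)"
      proof (rule ccontr)
        assume not: "\<not> w' (Suc (i j))"
        \<comment> \<open>In a twisted gluing, edge 24 of a piece is edge 1 of the next.\<close>
        have "emb w (Suc j) 1 = emb w j 24"
          using w by (simp add: emb_def swap01_def)
        moreover have "f (emb w j 24) = emb w' (i j) (\<gamma> j 24)"
          "f (emb w (Suc j) 1) = emb w' (i (Suc j)) (\<gamma> (Suc j) 1)"
          using piece[of j] piece[of "Suc j"] j by simp_all
        ultimately have "emb w' (Suc (i j)) (\<gamma> (Suc j) 1) = emb w' (i j) (\<gamma> j 24)"
          unfolding 1(3) by (simp only:)
        \<comment> \<open>In an untwisted target gluing edge 24 is edge 0 of the next piece, yet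
          only edge 0 can be sent to edge 0.\<close>
        then have "\<gamma> (Suc j) 1 = 0"
          using not p.right_end_fixed[OF 1(1)] by (simp add: emb_def)
        then show False
          using q.left_end_fixed[OF 1(2), of 1] by simp
      qed
      then show ?thesis using 1(3) by blast
    next
      case 2
      then show ?thesis using pent(1) pentagonal_simps(1) by simp
    qed
  qed
  have shift: "i j = i 0 + j" if "j < n" for j
    using that by (induction j) (use step in auto)
  show thesis
  proof (rule that[of "i 0"])
    show "i 0 + n \<le> m"
    proof -
      have "i (n - 1) < m" using piece[of "n - 1"] \<open>0 < n\<close> by simp
      then show ?thesis using shift[of "n - 1"] \<open>0 < n\<close> by linarith
    qed
    show "w' (i 0 + j)" if "0 < j" "j < n" "w j" for j
      using step[of "j - 1"] shift[of "j - 1"] that by simp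
  qed
qed

text \<open>Twisting exactly the first and the last gluing marks both extremities of the
  chain.\<close>

definition antichain_graph :: "nat \<Rightarrow> (nat, nat) multigraph" where
  "antichain_graph n = chain (\<lambda>j. j = 1 \<or> j = n - 1) n"

text \<open>Join 1 goes to the twisted join \<open>k + 1\<close>. If this were \<open>m - 1\<close>,
  at most two pieces would fit, so \<open>k = 0\<close>; then join \<open>n - 1\<close>, which is
  not 1, must be \<open>m - 1\<close>.\<close>

lemma cycle_continuous_antichain_graph:
  assumes "cycle_continuous (antichain_graph n) (antichain_graph m) f" "3 \<le> n" "3 \<le> m"
  shows "n = m"
proof -
  obtain k where k: "k + n \<le> m"
    "\<And>j. 0 < j \<Longrightarrow> j < n \<Longrightarrow> j = 1 \<or> j = n - 1 \<Longrightarrow> k + j = 1 \<or> k + j = m - 1"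
    using cycle_continuous_shift[OF assms(1)[unfolded antichain_graph_def]] assms(2,3) by auto
  show ?thesis
    using k(1) k(2)[of 1] k(2)[of "n - 1"] assms(2,3) by linarith
qed

theorem theorem1p3:
  shows "\<exists>\<G> :: (nat, nat) multigraph set. infinite \<G> \<and>
    (\<forall>G\<in>\<G>. fin_multigraph G \<and> cubic G \<and> bridgeless G) \<and>
    (\<forall>G\<in>\<G>. \<forall>G'\<in>\<G>. G \<noteq> G' \<longrightarrow> cc_incomparable G G')"
proof (intro exI[of _ "antichain_graph ` {3..}"] conjI ballI impI)
  have "inj_on antichain_graph {3..}"
  proof (rule inj_onI)
    fix n m assume "antichain_graph n = antichain_graph m"
    then have "edges (antichain_graph n) = edges (antichain_graph m)" by simp
    then have "{..<24 * n + 3} = {..<24 * m + 3}"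
      by (simp add: antichain_graph_def chain_simps)
    then show "n = m" by simp
  qed
  then show "infinite (antichain_graph ` {3..})"
    by (simp add: finite_image_iff infinite_Ici)
next
  fix G assume "G \<in> antichain_graph ` {3..}"
  then obtain n where "3 \<le> n" "G = antichain_graph n" by auto
  then show "fin_multigraph G" "cubic G" "bridgeless G"
    by (simp_all add: antichain_graph_def fin_multigraph_chain cubic_chain bridgeless_chain)
next
  fix G G' assume "G \<in> antichain_graph ` {3..}" "G' \<in> antichain_graph ` {3..}" "G \<noteq> G'"
  then obtain n m where "3 \<le> n" "3 \<le> m" "n \<noteq> m" "G = antichain_graph n" "G' = antichain_graph m"
    by auto
  then show "cc_incomparable G G'"
    unfolding cc_incomparable_def using cycle_continuous_antichain_graph by metis
qed

end
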